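(* Let $d>k\geq 1$ be integers, let $\varepsilon\in(0,1)$, and let $A\in\mathbb{R}^{d\times d}$ be symmetric positive semidefinite with $\lambda_k>\lambda_{k+1}$. Let $X_0\in\mathrm{St}(d,k)$ satisfy $\cos\theta_k(U_k,X_0)>0$, and let $\beta>0$ satisfy $\lambda_k>2\sqrt{\beta}\geq\lambda_{k+1}$. Consider the ANPM iterates $(X_t)_{t\geq0}$ with momentum $\beta$ and perturbations $(\Xi_t)_{t\geq0}\subset\mathbb{R}^{d\times k}$ satisfying, for all $t\geq 0$, $$\|U_{-k}^\top \Xi_t\|_2\leq c(\lambda_k-2\sqrt{\beta})\varepsilon,\qquad \|U_k^\top\Xi_t\|_2\leq c(\lambda_k-2\sqrt{\beta})\cos\theta_k(U_k,X_t),$$ where $c:=1/32$. Let $h_0:=\tan\theta_k(U_k,X_0)$ and $$T:=\frac{\log(2h_0/\varepsilon)}{-\log\left(1-\frac12\sqrt{\frac{\lambda_k-2\sqrt{\beta}}{\lambda_k}}\right)}.$$ Then for every integer $t\geq T$, $\sin\theta_k(U_k,X_t)\leq\varepsilon$. (In particular $T=O\big(\sqrt{\lambda_k/(\lambda_k-2\sqrt\beta)}\,\log(\tan\theta_k(U_k,X_0)/\varepsilon)\big)$.)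
   Context: $A$ has eigenvalues $\lambda_1\geq\dots\geq\lambda_d\geq0$ with corresponding orthonormal eigenvectors $u_1,\dots,u_d$; $U_k:=[u_1,\dots,u_k]$, $U_{-k}:=[u_{k+1},\dots,u_d]$. $\mathrm{St}(d,k):=\{X\in\mathbb{R}^{d\times k}:X^\top X=I_k\}$. For $Y\in\mathbb{R}^{d\times k}$, $\mathrm{QR}(Y)$ is the pair $(X,R)$ with $Y=XR$, $X\in\mathrm{St}(d,k)$, $R\in\mathbb{R}^{k\times k}$ upper triangular with nonnegative diagonal (unique, with $R$ invertible, when $Y$ has full column rank). For $U,X\in\mathrm{St}(d,k)$, the $k$-th principal angle is $\theta_k(U,X):=\arccos\sigma_{\min}(U^\top X)\in[0,\pi/2]$. The Accelerated Noisy Power Method (ANPM) with momentum $\beta>0$ and perturbations $(\Xi_t)_{t\geq0}$ is: given $X_0\in\mathrm{St}(d,k)$, $(X_1,R_1)=\mathrm{QR}(\tfrac12 AX_0+\Xi_0)$, and for $t\geq1$, $Y_{t+1}=AX_t-\beta X_{t-1}R_t^{-1}+\Xi_t$, $(X_{t+1},R_{t+1})=\mathrm{QR}(Y_{t+1})$. The perturbation $\Xi_t$ may depend on the iterates. *)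

theory Defs
  imports "HOL-Analysis.Analysis" "Jordan_Normal_Form.Matrix"
begin

(* Matrices are Jordan_Normal_Form matrices (real mat) with explicit dimensions.
   Indices are 0-based: the paper's u_1..u_d are u 0 .. u (d-1). *)

definition vnorm :: "real vec \<Rightarrow> real" where
  "vnorm v = sqrt (v \<bullet> v)"

definition spec_norm :: "real mat \<Rightarrow> real" where
  "spec_norm M = Sup {vnorm (M *\<^sub>v x) | x. x \<in> carrier_vec (dim_col M) \<and> vnorm x = 1}"

definition sigma_min :: "real mat \<Rightarrow> real" where
  "sigma_min M = Inf {vnorm (M *\<^sub>v x) | x. x \<in> carrier_vec (dim_col M) \<and> vnorm x = 1}"

definition stiefel :: "nat \<Rightarrow> nat \<Rightarrow> real mat set" where
  "stiefel d k = {X. X \<in> carrier_mat d k \<and> transpose_mat X * X = 1\<^sub>m k}"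

definition theta_k :: "real mat \<Rightarrow> real mat \<Rightarrow> real" where
  "theta_k U X = arccos (sigma_min (transpose_mat U * X))"

definition is_QR :: "real mat \<Rightarrow> real mat \<Rightarrow> real mat \<Rightarrow> bool" where
  "is_QR Y X R \<longleftrightarrow> X \<in> stiefel (dim_row Y) (dim_col Y) \<and>
     R \<in> carrier_mat (dim_col Y) (dim_col Y) \<and> upper_triangular R \<and>
     (\<forall>i < dim_col Y. R $$ (i, i) \<ge> 0) \<and> Y = X * R"

definition mat_inv :: "real mat \<Rightarrow> real mat" where
  "mat_inv R = (SOME B. inverts_mat R B \<and> inverts_mat B R)"

end

theory Submission
  imports Defs "Jordan_Normal_Form.Determinant"
begin

text \<open>
  Fix a vector \<open>x\<close> and undo the normalisations: with \<open>s\<^sub>0 = x\<close>, \<open>s\<^sub>t\<^sub>+\<^sub>1 = R\<^sub>t\<^sub>+\<^sub>1 s\<^sub>t\<close> the vectors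
  \<open>z\<^sub>t = X\<^sub>t s\<^sub>t\<close> satisfy the linear recurrence \<open>z\<^sub>t\<^sub>+\<^sub>1 = A z\<^sub>t - \<beta> z\<^sub>t\<^sub>-\<^sub>1 + \<Xi>\<^sub>t s\<^sub>t\<close>, and the
  perturbation bounds become bounds relative to the coordinates of \<open>z\<^sub>t\<close> in the eigenbasis. Scale by
  \<open>s = sqrt \<beta>\<close> and write \<open>\<lambda>\<^sub>k = s (2 + 32 g\<^sup>2)\<close>, so that \<open>c (\<lambda>\<^sub>k - 2 s) = s g\<^sup>2\<close>.
  The norm of the dominant coordinates grows at least like the solution of
  \<open>P\<^sub>t\<^sub>+\<^sub>1 = (2 + 31 g\<^sup>2) P\<^sub>t - P\<^sub>t\<^sub>-\<^sub>1\<close>; in particular it never vanishes, which makes every \<open>R\<^sub>t\<close> invertible.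
  The remaining coordinates are given by Chebyshev polynomials evaluated in \<open>[-2s, 2s]\<close>, hence are
  bounded by the worst case \<open>\<lambda>\<^sub>i = 2 s\<close>, whose recurrence has an explicit supersolution.
  The quotient of the two bounds controls the tangent of the principal angle.
\<close>

section \<open>Rescaled Chebyshev polynomials and the scalar momentum recurrence\<close>

text \<open>For \<open>b = s\<^sup>2\<close> these are \<open>s^n T\<^sub>n (x / (2 s))\<close> and \<open>s^n U\<^sub>n (x / (2 s))\<close>.\<close>

fun cheb_T :: "real \<Rightarrow> real \<Rightarrow> nat \<Rightarrow> real" where
  "cheb_T b x 0 = 1"
| "cheb_T b x (Suc 0) = x / 2"
| "cheb_T b x (Suc (Suc n)) = x * cheb_T b x (Suc n) - b * cheb_T b x n"

fun cheb_U :: "real \<Rightarrow> real \<Rightarrow> nat \<Rightarrow> real" where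
  "cheb_U b x 0 = 1"
| "cheb_U b x (Suc 0) = x"
| "cheb_U b x (Suc (Suc n)) = x * cheb_U b x (Suc n) - b * cheb_U b x n"

text \<open>The formula \<open>cos ((n+2) \<phi>) + cos (n \<phi>) = 2 cos \<phi> cos ((n+1)
  \<phi>)\<close>, scaled by \<open>s ^ (n+2)\<close>, is the recurrence of
  \<open>cheb_T\<close>.\<close>

lemma cheb_T_cos: "cheb_T (s\<^sup>2) (2 * s * cos \<phi>) n = s ^ n * cos (real n * \<phi>)"
proof (induction "s\<^sup>2" "2 * s * cos \<phi>" n rule: cheb_T.induct)
  case (3 n)
  have "cos (real (Suc (Suc n)) * \<phi>) = cos (real (Suc n) * \<phi> + \<phi>)"
    and "cos (real n * \<phi>) = cos (real (Suc n) * \<phi> - \<phi>)"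
    by (simp_all add: algebra_simps)
  then have "cos (real (Suc (Suc n)) * \<phi>) = 2 * cos \<phi> * cos (real (Suc n) * \<phi>) - cos (real n * \<phi>)"
    by (simp add: cos_add cos_diff)
  then have "s ^ Suc (Suc n) * cos (real (Suc (Suc n)) * \<phi>)
      = 2 * s * cos \<phi> * (s ^ Suc n * cos (real (Suc n) * \<phi>)) - s\<^sup>2 * (s ^ n * cos (real n * \<phi>))"
    by (simp only: power_Suc power2_eq_square) (simp only: algebra_simps)
  then show ?case
    by (simp only: cheb_T.simps 3)
qed auto

lemma abs_cheb_T_le:
  assumes "0 < s" "\<bar>x\<bar> \<le> 2 * s"
  shows "\<bar>cheb_T (s\<^sup>2) x n\<bar> \<le> s ^ n"
proof -
  have "\<bar>x / (2 * s)\<bar> \<le> 1"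
    using assms by (simp add: abs_divide)
  then have "-1 \<le> x / (2 * s)" "x / (2 * s) \<le> 1"
    by linarith+
  then have "x = 2 * s * cos (arccos (x / (2 * s)))"
    using assms by (simp add: cos_arccos)
  then have "cheb_T (s\<^sup>2) x n = s ^ n * cos (real n * arccos (x / (2 * s)))"
    by (metis cheb_T_cos)
  then show ?thesis
    using assms by (simp add: abs_mult mult_left_le)
qed

text \<open>The analogue of the addition formula for \<open>sin ((n+2) \<phi>)\<close>. It lets the
  bound on \<open>cheb_T\<close> pass to \<open>cheb_U\<close> by induction, without dividing by
  \<open>sin \<phi>\<close>.\<close>

lemma cheb_U_Suc: "cheb_U b x (Suc n) = x / 2 * cheb_U b x n + cheb_T b x (Suc n)"
proof (induction b x n rule: cheb_U.induct)
  case (3 b x n)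
  have "cheb_U b x (Suc (Suc (Suc n))) = x * cheb_U b x (Suc (Suc n)) - b * cheb_U b x (Suc n)"
    by (rule cheb_U.simps)
  also have "\<dots> = x * (x / 2 * cheb_U b x (Suc n) + cheb_T b x (Suc (Suc n)))
      - b * (x / 2 * cheb_U b x n + cheb_T b x (Suc n))"
    by (simp only: 3)
  also have "\<dots> = x / 2 * cheb_U b x (Suc (Suc n)) + cheb_T b x (Suc (Suc (Suc n)))"
    unfolding cheb_U.simps(3)[of b x n] cheb_T.simps(3)[of b x "Suc n"] by (simp only: algebra_simps)
  finally show ?case .
qed auto

text \<open>Equality holds at \<open>x = 2 * s\<close>, the worst case for the remaining
  eigenvalues.\<close>

lemma abs_cheb_U_le:
  assumes "0 < s" "\<bar>x\<bar> \<le> 2 * s"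
  shows "\<bar>cheb_U (s\<^sup>2) x n\<bar> \<le> real (Suc n) * s ^ n"
proof (induction n)
  case (Suc n)
  have "\<bar>cheb_U (s\<^sup>2) x (Suc n)\<bar> \<le> \<bar>x / 2\<bar> * \<bar>cheb_U (s\<^sup>2) x n\<bar> + \<bar>cheb_T (s\<^sup>2) x (Suc n)\<bar>"
    unfolding cheb_U_Suc abs_mult[symmetric] by (rule abs_triangle_ineq)
  also have "\<dots> \<le> s * (real (Suc n) * s ^ n) + s ^ Suc n"
    using assms Suc abs_cheb_T_le[OF assms, of "Suc n"] by (intro add_mono mult_mono) auto
  finally show ?case
    by (simp add: algebra_simps)
qed auto

text \<open>Superposition: the initial value evolves by \<open>cheb_T\<close>, because the first
  step uses \<open>x / 2\<close>, and each perturbation \<open>f j\<close> starts a fresh copy of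
  \<open>cheb_U\<close> at time \<open>Suc j\<close>.\<close>

lemma momentum_recurrence_solution:
  fixes y f :: "nat \<Rightarrow> real"
  assumes "y 1 = x / 2 * y 0 + f 0"
    and "\<And>t. Suc t < n \<Longrightarrow> y (Suc (Suc t)) = x * y (Suc t) - b * y t + f (Suc t)"
    and "t \<le> n"
  shows "y t = cheb_T b x t * y 0 + (\<Sum>j<t. cheb_U b x (t - Suc j) * f j)"
  using \<open>t \<le> n\<close>
proof (induction t rule: less_induct)
  case (less t)
  consider "t = 0" | "t = 1" | r where "t = Suc (Suc r)"
    by (metis One_nat_def not0_implies_Suc)
  then show ?case
  proof cases
    case 3
    \<comment> \<open>This fails at \<open>j = r\<close>, where \<open>r - Suc j\<close> is
      truncated to 0. The last two summands, with coefficients \<open>x\<close> and 1, are therefore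
      split off below.\<close>
    have U: "cheb_U b x (Suc (Suc r) - Suc j)
        = x * cheb_U b x (Suc r - Suc j) - b * cheb_U b x (r - Suc j)" if "j < r" for j
    proof -
      obtain i where "r = Suc (j + i)"
        using less_imp_Suc_add[OF \<open>j < r\<close>] by blast
      then show ?thesis by simp
    qed
    have "y t = x * y (Suc r) - b * y r + f (Suc r)"
      using assms(2)[of r] less.prems 3 by simp
    also have "y (Suc r) = cheb_T b x (Suc r) * y 0 + (\<Sum>j<Suc r. cheb_U b x (Suc r - Suc j) * f j)"
      by (rule less.IH) (use less.prems 3 in auto)
    also have "y r = cheb_T b x r * y 0 + (\<Sum>j<r. cheb_U b x (r - Suc j) * f j)"
      by (rule less.IH) (use less.prems 3 in auto)
    finally have "y t = x * (cheb_T b x (Suc r) * y 0 + (\<Sum>j<Suc r. cheb_U b x (Suc r - Suc j) * f j))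
       - b * (cheb_T b x r * y 0 + (\<Sum>j<r. cheb_U b x (r - Suc j) * f j)) + f (Suc r)" .
    moreover have "(\<Sum>j<r. cheb_U b x (Suc (Suc r) - Suc j) * f j)
       = x * (\<Sum>j<r. cheb_U b x (Suc r - Suc j) * f j) - b * (\<Sum>j<r. cheb_U b x (r - Suc j) * f j)"
      unfolding sum_distrib_left sum_subtractf[symmetric]
      by (rule sum.cong) (simp_all only: U lessThan_iff left_diff_distrib mult.assoc)
    moreover have "(\<Sum>j<Suc (Suc r). cheb_U b x (Suc (Suc r) - Suc j) * f j)
       = (\<Sum>j<r. cheb_U b x (Suc (Suc r) - Suc j) * f j) + x * f r + f (Suc r)"
      and "(\<Sum>j<Suc r. cheb_U b x (Suc r - Suc j) * f j)
       = (\<Sum>j<r. cheb_U b x (Suc r - Suc j) * f j) + f r"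
      by simp_all
    ultimately show ?thesis
      unfolding 3 cheb_T.simps(3) by (simp only: algebra_simps)
  qed (use assms in auto)
qed

section \<open>Euclidean norms of families of coordinates\<close>

lemma L2_set_sum_le: "finite J \<Longrightarrow> L2_set (\<lambda>i. \<Sum>j\<in>J. h j i) K \<le> (\<Sum>j\<in>J. L2_set (h j) K)"
proof (induction J rule: finite_induct)
  case (insert j J)
  then show ?case
    using L2_set_triangle_ineq[of "h j" "\<lambda>i. \<Sum>j\<in>J. h j i" K] by simp
qed (simp add: L2_set_def)

lemma L2_set_mult_le:
  assumes "\<And>i. i \<in> K \<Longrightarrow> \<bar>q i\<bar> \<le> C" "0 \<le> C"
  shows "L2_set (\<lambda>i. q i * h i) K \<le> C * L2_set h K"
proof -
  have "L2_set (\<lambda>i. q i * h i) K = L2_set (\<lambda>i. \<bar>q i * h i\<bar>) K"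
    by (simp add: L2_set_def)
  also have "\<dots> \<le> L2_set (\<lambda>i. C * \<bar>h i\<bar>) K"
    using assms by (intro L2_set_mono) (auto simp: abs_mult mult_right_mono)
  also have "\<dots> = C * L2_set (\<lambda>i. \<bar>h i\<bar>) K"
    using assms(2) by (rule L2_set_right_distrib[symmetric])
  also have "L2_set (\<lambda>i. \<bar>h i\<bar>) K = L2_set h K"
    by (simp add: L2_set_def)
  finally show ?thesis .
qed

lemma L2_set_mult_ge:
  assumes "\<And>i. i \<in> K \<Longrightarrow> C \<le> q i" "0 \<le> C"
  shows "C * L2_set h K \<le> L2_set (\<lambda>i. q i * h i) K"
proof -
  have "C * L2_set h K = L2_set (\<lambda>i. C * \<bar>h i\<bar>) K"
    using assms(2) by (simp add: L2_set_right_distrib) (simp add: L2_set_def power_mult_distrib)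
  also have "\<dots> \<le> L2_set (\<lambda>i. q i * \<bar>h i\<bar>) K"
    using assms by (intro L2_set_mono) (auto simp: mult_right_mono)
  also have "\<dots> = L2_set (\<lambda>i. q i * h i) K"
    by (simp add: L2_set_def power_mult_distrib)
  finally show ?thesis .
qed

lemma L2_set_diff_ge: "L2_set h K - L2_set h' K \<le> L2_set (\<lambda>i. h i + h' i) K"
proof -
  have "L2_set h K = L2_set (\<lambda>i. (h i + h' i) + - h' i) K"
    by simp
  also have "\<dots> \<le> L2_set (\<lambda>i. h i + h' i) K + L2_set (\<lambda>i. - h' i) K"
    by (rule L2_set_triangle_ineq)
  also have "L2_set (\<lambda>i. - h' i) K = L2_set h' K"
    by (simp add: L2_set_def)
  finally show ?thesis by simp
qed

text \<open>In the coordinatewise solution formula the multipliers are bounded uniformly in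
  \<open>i\<close>, so Minkowski's inequality carries the scalar estimate over to the norm.\<close>

lemma momentum_recurrence_L2_le:
  fixes z f :: "nat \<Rightarrow> 'i \<Rightarrow> real"
  assumes s: "0 < s" and lam: "\<And>i. i \<in> K \<Longrightarrow> \<bar>lam i\<bar> \<le> 2 * s"
    and z1: "\<And>i. i \<in> K \<Longrightarrow> z 1 i = lam i / 2 * z 0 i + f 0 i"
    and z2: "\<And>t i. i \<in> K \<Longrightarrow> Suc t < n \<Longrightarrow>
      z (Suc (Suc t)) i = lam i * z (Suc t) i - s\<^sup>2 * z t i + f (Suc t) i"
    and "t \<le> n"
  shows "L2_set (z t) K \<le> s ^ t * L2_set (z 0) K
    + (\<Sum>j<t. real (t - j) * s ^ (t - Suc j) * L2_set (f j) K)"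
proof -
  have "L2_set (z t) K = L2_set (\<lambda>i. cheb_T (s\<^sup>2) (lam i) t * z 0 i
      + (\<Sum>j<t. cheb_U (s\<^sup>2) (lam i) (t - Suc j) * f j i)) K"
  proof (rule L2_set_cong)
    fix i assume i: "i \<in> K"
    show "z t i = cheb_T (s\<^sup>2) (lam i) t * z 0 i
      + (\<Sum>j<t. cheb_U (s\<^sup>2) (lam i) (t - Suc j) * f j i)"
      using momentum_recurrence_solution[of "\<lambda>t. z t i" "lam i" "\<lambda>t. f t i" n "s\<^sup>2" t]
        z1[OF i] z2[OF i] \<open>t \<le> n\<close> by simp
  qed auto
  also have "\<dots> \<le> L2_set (\<lambda>i. cheb_T (s\<^sup>2) (lam i) t * z 0 i) K
      + (\<Sum>j<t. L2_set (\<lambda>i. cheb_U (s\<^sup>2) (lam i) (t - Suc j) * f j i) K)"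
    by (intro order_trans[OF L2_set_triangle_ineq] add_left_mono L2_set_sum_le) auto
  also have "\<dots> \<le> s ^ t * L2_set (z 0) K
      + (\<Sum>j<t. (real (Suc (t - Suc j)) * s ^ (t - Suc j)) * L2_set (f j) K)"
    using s by (intro add_mono sum_mono L2_set_mult_le abs_cheb_T_le abs_cheb_U_le lam) auto
  also have "(\<Sum>j<t. (real (Suc (t - Suc j)) * s ^ (t - Suc j)) * L2_set (f j) K)
      = (\<Sum>j<t. real (t - j) * s ^ (t - Suc j) * L2_set (f j) K)"
    by (rule sum.cong) (auto simp: Suc_diff_Suc)
  finally show ?thesis .
qed

section \<open>Growth of the dominant coordinates\<close>

text \<open>The guaranteed growth of the dominant norm in units of \<open>s ^ t\<close>. The
  eigenvalue contributes \<open>2 + 32 * g^2\<close>, in the first step half of it, and the noise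
  removes \<open>g^2\<close>; hence 31 and 15.\<close>

fun gain :: "real \<Rightarrow> nat \<Rightarrow> real" where
  "gain g 0 = 1"
| "gain g (Suc 0) = 1 + 15 * g\<^sup>2"
| "gain g (Suc (Suc n)) = (2 + 31 * g\<^sup>2) * gain g (Suc n) - gain g n"

lemma gain_mono_pos: "0 < gain g n \<and> gain g n \<le> gain g (Suc n)"
proof (induction n)
  case (Suc n)
  have "0 \<le> (31 * g\<^sup>2) * gain g (Suc n)"
    using Suc by (intro mult_nonneg_nonneg) auto
  with Suc show ?case
    by (simp only: gain.simps distrib_right) linarith
qed auto

lemma gain_pos: "0 < gain g n"
  using gain_mono_pos by blast

text \<open>A lower bound \<open>r\<close> on the ratio of consecutive norms yields
  \<open>s * (2 + 31 * g^2) - s^2 / r\<close> for the next ratio. This is increasing in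
  \<open>r\<close>, and the ratios of \<open>s ^ t * gain g t\<close> satisfy it with equality. The
  claim is cross-multiplied because the norms may vanish. The horizon \<open>n\<close> permits its
  use when the recurrence is known only up to some step.\<close>

lemma momentum_recurrence_growth:
  fixes z f :: "nat \<Rightarrow> 'i \<Rightarrow> real"
  assumes s: "0 < s" and lam: "\<And>i. i \<in> K \<Longrightarrow> s * (2 + 32 * g\<^sup>2) \<le> lam i"
    and z1: "\<And>i. i \<in> K \<Longrightarrow> z 1 i = lam i / 2 * z 0 i + f 0 i"
    and z2: "\<And>t i. i \<in> K \<Longrightarrow> Suc t < n \<Longrightarrow>
      z (Suc (Suc t)) i = lam i * z (Suc t) i - s\<^sup>2 * z t i + f (Suc t) i"
    and f: "\<And>t. t < n \<Longrightarrow> L2_set (f t) K \<le> s * g\<^sup>2 * L2_set (z t) K"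
    and "t < n"
  shows "s * gain g (Suc t) * L2_set (z t) K \<le> gain g t * L2_set (z (Suc t)) K"
  using \<open>t < n\<close>
proof (induction t)
  case 0
  have "L2_set (z 1) K = L2_set (\<lambda>i. lam i / 2 * z 0 i + f 0 i) K"
    using z1 by (intro L2_set_cong) auto
  moreover have "L2_set (\<lambda>i. lam i / 2 * z 0 i) K - L2_set (f 0) K \<le> \<dots>"
    by (rule L2_set_diff_ge)
  moreover have "s * (1 + 16 * g\<^sup>2) * L2_set (z 0) K \<le> L2_set (\<lambda>i. lam i / 2 * z 0 i) K"
  proof (rule L2_set_mult_ge)
    show "s * (1 + 16 * g\<^sup>2) \<le> lam i / 2" if "i \<in> K" for i
      using lam[OF that] by (simp add: algebra_simps)
  qed (use s in simp)
  ultimately show ?case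
    using f[of 0] 0 by (simp add: algebra_simps)
next
  case (Suc t)
  let ?G = "gain g" and ?a = "\<lambda>t. L2_set (z t) K"
  have "?a (Suc (Suc t)) = L2_set (\<lambda>i. (lam i * z (Suc t) i + - (s\<^sup>2) * z t i) + f (Suc t) i) K"
    using z2 Suc.prems by (intro L2_set_cong) auto
  moreover have "L2_set (\<lambda>i. lam i * z (Suc t) i + - (s\<^sup>2) * z t i) K - L2_set (f (Suc t)) K \<le> \<dots>"
    by (rule L2_set_diff_ge)
  moreover have "L2_set (\<lambda>i. lam i * z (Suc t) i) K - L2_set (\<lambda>i. - (s\<^sup>2) * z t i) K
      \<le> L2_set (\<lambda>i. lam i * z (Suc t) i + - (s\<^sup>2) * z t i) K"
    by (rule L2_set_diff_ge)
  moreover have "s * (2 + 32 * g\<^sup>2) * ?a (Suc t) \<le> L2_set (\<lambda>i. lam i * z (Suc t) i) K"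
    using s lam by (intro L2_set_mult_ge) auto
  moreover have "L2_set (\<lambda>i. - (s\<^sup>2) * z t i) K \<le> s\<^sup>2 * ?a t"
    by (intro L2_set_mult_le) auto
  ultimately have *: "s * (2 + 31 * g\<^sup>2) * ?a (Suc t) - s\<^sup>2 * ?a t \<le> ?a (Suc (Suc t))"
    using f[OF Suc.prems] by (simp add: algebra_simps)
  have IH: "s * ?G (Suc t) * ?a t \<le> ?G t * ?a (Suc t)"
    using Suc by simp
  \<comment> \<open>After multiplication by \<open>?G (Suc t)\<close> the induction hypothesis
    replaces the term with \<open>?a t\<close> by one with \<open>?a (Suc t)\<close>, whose total
    coefficient is \<open>s * ?G (Suc (Suc t))\<close>.\<close>
  have "?G (Suc t) * (s * (2 + 31 * g\<^sup>2) * ?a (Suc t) - s\<^sup>2 * ?a t) \<le> ?G (Suc t) * ?a (Suc (Suc t))"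
    using * gain_pos[of g "Suc t"] by (intro mult_left_mono) auto
  moreover have "s * (s * ?G (Suc t) * ?a t) \<le> s * (?G t * ?a (Suc t))"
    using IH s by (intro mult_left_mono) auto
  ultimately show ?case
    by (simp add: algebra_simps power2_eq_square)
qed

section \<open>An explicit majorant for the remaining coordinates\<close>

text \<open>The kernel \<open>t - j\<close> inverts the second difference, with
  \<open>\<phi> 0\<close> as initial slope; summing the hypotheses twice gives the bound.\<close>

lemma second_difference_majorant:
  fixes w \<phi> :: "nat \<Rightarrow> real"
  assumes "h \<le> w 0" "\<phi> 0 \<le> w 1 - w 0"
    and "\<And>t. \<phi> (Suc t) \<le> w (Suc (Suc t)) - 2 * w (Suc t) + w t"
  shows "h + (\<Sum>j<t. real (t - j) * \<phi> j) \<le> w t"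
proof -
  have diff: "(\<Sum>j\<le>t. \<phi> j) \<le> w (Suc t) - w t" for t
  proof (induction t)
    case (Suc t)
    then show ?case using assms(3)[of t] by simp
  qed (use assms in simp)
  show ?thesis
  proof (induction t)
    case (Suc t)
    have "(\<Sum>j<Suc t. real (Suc t - j) * \<phi> j) = (\<Sum>j<Suc t. real (t - j) * \<phi> j + \<phi> j)"
      by (intro sum.cong) (auto simp: Suc_diff_le algebra_simps)
    also have "\<dots> = (\<Sum>j<t. real (t - j) * \<phi> j) + (\<Sum>j\<le>t. \<phi> j)"
      by (simp add: sum.distrib lessThan_Suc_atMost[symmetric])
    finally show ?case using Suc diff[of t] by simp
  qed (use assms in simp)
qed

text \<open>An upper bound for the larger root of \<open>(x - 1)^2 = g^2 * x\<close>, the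
  characteristic equation of \<open>w (t+2) - 2 * w (t+1) + w t = g^2 * w (t+1)\<close>.\<close>

definition growth :: "real \<Rightarrow> real" where
  "growth g = 1 + g + 3 * g\<^sup>2"

text \<open>The least multiple of \<epsilon> that makes the first step of
  \<open>majorant_dominates\<close> work for \<open>h = 0\<close>; there
  \<open>8 / 15 = 1 + 1 / 30 - 1 / 2\<close>.\<close>

definition offset :: "real \<Rightarrow> real" where
  "offset g = 8 / 15 * g / (1 + 2 * g)"

text \<open>The second difference of \<open>gain g\<close> is \<open>31 * g^2 * gain g\<close>, so
  the share \<open>\<epsilon> / 30\<close> pays exactly for the forcing
  \<open>\<epsilon> * g^2 * gain g\<close> and for its own feedback. The exponential term carries
  the initial data.\<close>

definition majorant :: "real \<Rightarrow> real \<Rightarrow> real \<Rightarrow> nat \<Rightarrow> real" where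
  "majorant g \<epsilon> h t = \<epsilon> / 30 * gain g t + (h + offset g * \<epsilon>) * growth g ^ t"

text \<open>The majorant also occurs on the left, since the noise on the remaining coordinates
  depends on their own size. This form closes the induction in
  \<open>momentum_recurrence_ratio_le\<close>.\<close>

lemma majorant_dominates:
  assumes g: "0 < g" and \<epsilon>: "0 < \<epsilon>" and h: "0 \<le> h"
  shows "h + (\<Sum>j<t. real (t - j) * (g\<^sup>2 * (\<epsilon> * gain g j + majorant g \<epsilon> h j))) \<le> majorant g \<epsilon> h t"
proof (rule second_difference_majorant)
  define C where "C = h + offset g * \<epsilon>"
  have C: "offset g * \<epsilon> \<le> C" "0 \<le> C"
    using g \<epsilon> h by (auto simp: C_def offset_def)
  have w: "majorant g \<epsilon> h t = \<epsilon> / 30 * gain g t + C * growth g ^ t" for t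
    by (simp add: majorant_def C_def)
  have \<alpha>: "0 < growth g" using g by (simp add: growth_def add_pos_nonneg)
  show "h \<le> majorant g \<epsilon> h 0"
    using g \<epsilon> h by (simp add: majorant_def offset_def)
  have "offset g * \<epsilon> * (1 + 2 * g) \<le> C * (1 + 2 * g)"
    using C g by (intro mult_right_mono) auto
  moreover have "offset g * (1 + 2 * g) = 8 / 15 * g"
  proof -
    have "1 + 2 * g \<noteq> 0" using g by linarith
    then show ?thesis unfolding offset_def by (metis nonzero_eq_divide_eq)
  qed
  ultimately have "8 / 15 * g * \<epsilon> \<le> C * (1 + 2 * g)"
    by (metis mult.commute mult.left_commute)
  then have "g * (8 / 15 * g * \<epsilon>) \<le> g * (C * (1 + 2 * g))"
    using g by (intro mult_left_mono) auto
  then show "g\<^sup>2 * (\<epsilon> * gain g 0 + majorant g \<epsilon> h 0) \<le> majorant g \<epsilon> h 1 - majorant g \<epsilon> h 0"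
    by (simp add: w growth_def algebra_simps power2_eq_square)
  fix t
  \<comment> \<open>The \<open>gain\<close> parts cancel, so only the surplus of
    \<open>growth g\<close> in the characteristic equation, \<open>5 * g ^ 3 + 6 * g ^ 4\<close>,
    has to be nonnegative.\<close>
  have "0 \<le> (5 * g ^ 3 + 6 * g ^ 4) * (C * growth g ^ t)"
    using g C \<alpha> by (intro mult_nonneg_nonneg) auto
  moreover have "(growth g)\<^sup>2 - 2 * growth g + 1 - g\<^sup>2 * growth g = 5 * g ^ 3 + 6 * g ^ 4"
    by (simp add: growth_def algebra_simps power2_eq_square power3_eq_cube power4_eq_xxxx)
  ultimately have "0 \<le> ((growth g)\<^sup>2 - 2 * growth g + 1 - g\<^sup>2 * growth g) * (C * growth g ^ t)"
    by simp
  then show "g\<^sup>2 * (\<epsilon> * gain g (Suc t) + majorant g \<epsilon> h (Suc t))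
     \<le> majorant g \<epsilon> h (Suc (Suc t)) - 2 * majorant g \<epsilon> h (Suc t) + majorant g \<epsilon> h t"
    by (simp add: w algebra_simps power2_eq_square)
qed

section \<open>Comparison of the exponential rates\<close>

text \<open>The second factor bounds \<open>1 / \<rho>\<close> from above, where \<open>\<rho>\<close> is the contraction factor in the theorem.\<close>

definition rate :: "real \<Rightarrow> real" where
  "rate g = growth g * (1 + 2 * g + 8 * g\<^sup>2) / (1 + 4 * g\<^sup>2)"

text \<open>The difference \<open>D\<close> of the two sides satisfies \<open>D\<^sub>t\<^sub>+\<^sub>1 \<ge> (2 + 31 g\<^sup>2) D\<^sub>t - D\<^sub>t\<^sub>-\<^sub>1\<close>, and such a
  sequence stays nonnegative as soon as it cannot decay faster than by the factor \<open>1 / (1 + 5 g)\<close>.\<close>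

lemma gain_ge_rate_power:
  assumes g: "0 < g"
  shows "30 / 29 * (1 / 2 + offset g) * rate g ^ t \<le> gain g t"
proof -
  \<comment> \<open>The constant of the claim over a common denominator.\<close>
  define m where "m = (15 + 46 * g) / (29 * (1 + 2 * g))"
  define B where "B = rate g"
  define D where "D t = gain g t - m * B ^ t" for t
  define N where "N = 1 + 4 * g\<^sup>2"
  define Q where "Q = 3 + 9 * g + 14 * g\<^sup>2 + 24 * g ^ 3"
  have N: "0 < N" by (simp add: N_def add_pos_nonneg)
  have B1: "B = 1 + g * Q / N"
    using N unfolding B_def rate_def growth_def N_def[symmetric] Q_def
    by (simp add: field_simps) (simp add: N_def algebra_simps power2_eq_square power3_eq_cube power4_eq_xxxx)
  have Q: "0 < Q" using g by (simp add: Q_def add_pos_pos)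
  have B0: "0 < B" using B1 Q N g by (simp add: add_pos_pos)
  have m0: "0 < m" using g by (simp add: m_def)
  have D0: "0 \<le> D 0" using g by (simp add: D_def m_def)
  \<comment> \<open>With \<open>B - 1 = g * Q / N\<close> this is
    \<open>(B - 1)^2 \<le> 31 * g^2 * B\<close> cleared of denominators: \<open>B\<close> lies
    between the characteristic roots of the \<open>gain\<close> recurrence.\<close>
  have "Q\<^sup>2 \<le> 31 * (N * (N + g * Q))"
  proof -
    have "31 * (N * (N + g * Q)) - Q\<^sup>2 = 22 + 39 * g + 362 * g ^ 2 + 410 * g ^ 3 + 1728 * g ^ 4
        + 1064 * g ^ 5 + 2400 * g ^ 6"
      by (simp add: N_def Q_def algebra_simps power2_eq_square eval_nat_numeral)
    also have "\<dots> \<ge> 0" using g by simp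
    finally show ?thesis by simp
  qed
  then have "g\<^sup>2 * Q\<^sup>2 \<le> g\<^sup>2 * (31 * (N * (N + g * Q)))"
    by (intro mult_left_mono) auto
  then have "(B - 1)\<^sup>2 \<le> 31 * g\<^sup>2 * B"
    using N by (simp add: B1 field_simps power2_eq_square)
  then have K: "B\<^sup>2 + 1 \<le> (2 + 31 * g\<^sup>2) * B"
    by (simp add: algebra_simps power2_eq_square)
  have Dstep: "(2 + 31 * g\<^sup>2) * D (Suc t) - D t \<le> D (Suc (Suc t))" for t
  proof -
    have "m * B ^ t * (B\<^sup>2 + 1) \<le> m * B ^ t * ((2 + 31 * g\<^sup>2) * B)"
      using K m0 B0 by (intro mult_left_mono) auto
    then show ?thesis
      by (simp add: D_def algebra_simps power2_eq_square)
  qed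
  \<comment> \<open>A polynomial certificate for \<open>D 0 \<le> (1 + 5 * g) * D 1\<close>,
    obtained by multiplying with the positive denominators.\<close>
  have "0 \<le> g * (25 - 3 * g + 1336 * g ^ 2 + 2206 * g ^ 3 + 6056 * g ^ 4 + 11880 * g ^ 5)"
  proof -
    have "25 - 3 * g + 1336 * g ^ 2 = 24 + (1 - 3 * g / 2) ^ 2 + (1336 - 9 / 4) * g ^ 2"
      by (simp add: power2_eq_square algebra_simps)
    also have "\<dots> \<ge> 0" by simp
    finally show ?thesis using g by simp
  qed
  also have "\<dots> = 29 * (1 + 2 * g) * N * ((1 + 5 * g) * ((1 + 15 * g\<^sup>2) - m * B) - (1 - m))"
  proof -
    have eq: "m * (29 * (1 + 2 * g)) = 15 + 46 * g" "N * B = N + g * Q"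
      using g N by (simp_all add: m_def B1 field_simps)
    have "29 * (1 + 2 * g) * N * ((1 + 5 * g) * ((1 + 15 * g\<^sup>2) - m * B) - (1 - m))
        = N * (29 * (1 + 2 * g)) * ((1 + 5 * g) * (1 + 15 * g\<^sup>2) - 1)
          - m * (29 * (1 + 2 * g)) * ((1 + 5 * g) * (N * B) - N)"
      by (simp only: algebra_simps)
    also have "\<dots> = N * (29 * (1 + 2 * g)) * ((1 + 5 * g) * (1 + 15 * g\<^sup>2) - 1)
          - (15 + 46 * g) * ((1 + 5 * g) * (N + g * Q) - N)"
      by (simp only: eq)
    also have "\<dots> = g * (25 - 3 * g + 1336 * g ^ 2 + 2206 * g ^ 3 + 6056 * g ^ 4 + 11880 * g ^ 5)"
      by (simp add: N_def Q_def algebra_simps eval_nat_numeral)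
    finally show ?thesis by simp
  qed
  finally have "1 - m \<le> (1 + 5 * g) * ((1 + 15 * g\<^sup>2) - m * B)"
    using g N by (simp only: zero_le_mult_iff) (auto simp: mult_le_0_iff)
  then have D1: "D 0 \<le> (1 + 5 * g) * D 1"
    by (simp add: D_def)
  have "0 \<le> D t \<and> D t \<le> (1 + 5 * g) * D (Suc t)" for t
  proof (induction t)
    case (Suc t)
    then have "0 \<le> (1 + 5 * g) * D (Suc t)" by linarith
    then have p: "0 \<le> D (Suc t)" using g by (simp add: zero_le_mult_iff)
    \<comment> \<open>The decay bound reproduces itself because \<open>(1 + 5 * g) * (1 - 5 * g + 31
      * g^2) = 1 + 6 * g^2 + 155 * g ^ 3\<close>, which is at least 1.\<close>
    have "(2 + 31 * g\<^sup>2) * D (Suc t) - (1 + 5 * g) * D (Suc t) \<le> D (Suc (Suc t))"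
      using Dstep[of t] Suc by linarith
    then have "(1 + 5 * g) * ((1 - 5 * g + 31 * g\<^sup>2) * D (Suc t)) \<le> (1 + 5 * g) * D (Suc (Suc t))"
      using g by (intro mult_left_mono) (auto simp: algebra_simps)
    moreover have "0 \<le> (6 * g\<^sup>2 + 155 * g ^ 3) * D (Suc t)"
      using p g by simp
    ultimately show ?case
      using p by (simp add: algebra_simps power2_eq_square power3_eq_cube)
  qed (use D0 D1 in simp)
  then have "m * B ^ t \<le> gain g t" by (simp add: D_def)
  moreover have "30 / 29 * (1 / 2 + offset g) = m"
    using g by (simp add: m_def offset_def field_simps)
  ultimately show ?thesis by (simp add: B_def)
qed

section \<open>The quotient of remaining and dominant coordinates\<close>

text \<open>The normalised dominant norm \<open>a t / (s ^ t * gain g t)\<close> is nondecreasing.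
  Its final value \<open>M\<close> thus bounds all earlier ones, and the whole history of the noise
  can be measured in units of \<open>M\<close>.\<close>

lemma momentum_recurrence_ratio_le:
  fixes z f :: "nat \<Rightarrow> 'i \<Rightarrow> real"
  assumes s: "0 < s" and g: "0 < g" and \<epsilon>: "0 < \<epsilon>" and h: "0 \<le> h"
    and lamI: "\<And>i. i \<in> I \<Longrightarrow> s * (2 + 32 * g\<^sup>2) \<le> lam i"
    and lamJ: "\<And>i. i \<in> J \<Longrightarrow> \<bar>lam i\<bar> \<le> 2 * s"
    and z1: "\<And>i. i \<in> I \<union> J \<Longrightarrow> z 1 i = lam i / 2 * z 0 i + f 0 i"
    and z2: "\<And>t i. i \<in> I \<union> J \<Longrightarrow>
      z (Suc (Suc t)) i = lam i * z (Suc t) i - s\<^sup>2 * z t i + f (Suc t) i"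
    and fI: "\<And>t. L2_set (f t) I \<le> s * g\<^sup>2 * L2_set (z t) I"
    and fJ: "\<And>t. L2_set (f t) J \<le> s * g\<^sup>2 * (\<epsilon> * L2_set (z t) I + L2_set (z t) J)"
    and z0: "L2_set (z 0) J \<le> h * L2_set (z 0) I"
  shows "L2_set (z n) J * gain g n \<le> majorant g \<epsilon> h n * L2_set (z n) I"
proof -
  define a b M where "a t = L2_set (z t) I" and "b t = L2_set (z t) J"
    and "M = a n / (s ^ n * gain g n)" for t
  have up: "s * gain g (Suc t) * a t \<le> gain g t * a (Suc t)" for t
    unfolding a_def
    by (rule momentum_recurrence_growth[where n = "Suc t" and f = f and lam = lam])
      (use s lamI z1 z2 fI in auto)
  have "a t / (s ^ t * gain g t) \<le> a (Suc t) / (s ^ Suc t * gain g (Suc t))" for t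
    using up[of t] s gain_pos[of g t] gain_pos[of g "Suc t"]
    by (simp add: field_simps mult_left_mono)
  then have ratio: "a t / (s ^ t * gain g t) \<le> M" if "t \<le> n" for t
    unfolding M_def using that by (rule lift_Suc_mono_le[of "\<lambda>t. a t / (s ^ t * gain g t)"])
  then have aM: "a t \<le> M * s ^ t * gain g t" if "t \<le> n" for t
  proof -
    have "0 < s ^ t * gain g t" using s gain_pos by simp
    then show ?thesis
      using ratio[OF that] by (simp add: pos_divide_le_eq mult.assoc)
  qed
  have M0: "0 \<le> M"
    using s gain_pos[of g n] by (simp add: M_def a_def L2_set_nonneg)
  \<comment> \<open>Strong induction, since the noise at every earlier time \<open>j\<close>
    involves \<open>b j\<close>.\<close>
  have bM: "b t \<le> M * s ^ t * majorant g \<epsilon> h t" if "t \<le> n" for t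
    using that
  proof (induction t rule: less_induct)
    case (less t)
    have "b t \<le> s ^ t * b 0 + (\<Sum>j<t. real (t - j) * s ^ (t - Suc j) * L2_set (f j) J)"
      unfolding b_def
      by (rule momentum_recurrence_L2_le[where n = t and lam = lam])
        (use s lamJ z1 z2 in auto)
    also have "\<dots> \<le> s ^ t * (M * h) + (\<Sum>j<t. M * s ^ t *
        (real (t - j) * (g\<^sup>2 * (\<epsilon> * gain g j + majorant g \<epsilon> h j))))"
    proof (intro add_mono sum_mono)
      have "b 0 \<le> h * a 0" using z0 by (simp add: a_def b_def)
      also have "\<dots> \<le> h * M" using aM[of 0] h by (intro mult_left_mono) auto
      finally show "s ^ t * b 0 \<le> s ^ t * (M * h)"
        using s by (simp add: mult.commute)
      fix j assume "j \<in> {..<t}"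
      then have j: "j < t" by simp
      have "L2_set (f j) J \<le> s * g\<^sup>2 * (\<epsilon> * a j + b j)"
        using fJ by (simp add: a_def b_def)
      also have "\<dots> \<le> s * g\<^sup>2 * (\<epsilon> * (M * s ^ j * gain g j) + M * s ^ j * majorant g \<epsilon> h j)"
        using j less s \<epsilon> aM[of j] by (intro mult_left_mono add_mono) auto
      finally have "real (t - j) * s ^ (t - Suc j) * L2_set (f j) J
          \<le> real (t - j) * s ^ (t - Suc j) *
            (s * g\<^sup>2 * (\<epsilon> * (M * s ^ j * gain g j) + M * s ^ j * majorant g \<epsilon> h j))"
        using s by (intro mult_left_mono) auto
      also have "\<dots> = M * (s ^ (t - Suc j) * s ^ Suc j) *
          (real (t - j) * (g\<^sup>2 * (\<epsilon> * gain g j + majorant g \<epsilon> h j)))"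
        by (simp add: algebra_simps)
      also have "s ^ (t - Suc j) * s ^ Suc j = s ^ t"
        unfolding power_add[symmetric] using j by simp
      finally show "real (t - j) * s ^ (t - Suc j) * L2_set (f j) J \<le> M * s ^ t *
          (real (t - j) * (g\<^sup>2 * (\<epsilon> * gain g j + majorant g \<epsilon> h j)))" .
    qed
    also have "\<dots> = M * s ^ t * (h + (\<Sum>j<t. real (t - j) * (g\<^sup>2 * (\<epsilon> * gain g j + majorant g \<epsilon> h j))))"
      by (simp add: sum_distrib_left algebra_simps)
    also have "\<dots> \<le> M * s ^ t * majorant g \<epsilon> h t"
      using majorant_dominates[OF g \<epsilon> h] M0 s by (intro mult_left_mono) auto
    finally show ?case .
  qed
  have "b n * gain g n \<le> M * s ^ n * majorant g \<epsilon> h n * gain g n"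
    using bM[of n] gain_pos[of g n] by (intro mult_right_mono) auto
  also have "\<dots> = majorant g \<epsilon> h n * a n"
    using s gain_pos[of g n] by (simp add: M_def)
  finally show ?thesis by (simp add: a_def b_def)
qed

text \<open>Here \<open>q = 4 * g / sqrt (1 + 16 * g^2)\<close>. The root is at least
  \<open>(1 + 2 * g + 8 * g^2) / (1 + 2 * g)\<close>, with slack \<open>32 * g ^ 3\<close> after
  squaring and clearing denominators, so \<open>1 - q / 2\<close> is at least the reciprocal of the
  second factor of \<open>rate g\<close>.\<close>

lemma inverse_rate_le:
  assumes g: "0 < g" and s: "0 < s" and \<mu>: "\<mu> = s * (2 + 32 * g\<^sup>2)"
  defines "\<rho> \<equiv> 1 - 1 / 2 * sqrt ((\<mu> - 2 * s) / \<mu>)"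
  shows "0 < \<rho>" "\<rho> < 1" "growth g \<le> rate g * \<rho>"
proof -
  define q where "q = sqrt ((\<mu> - 2 * s) / \<mu>)"
  have l: "0 < \<mu>" "0 < \<mu> - 2 * s" using g s by (simp_all add: \<mu> algebra_simps add_pos_pos)
  then have q: "0 < q" "q < 1" using s by (simp_all add: q_def)
  have \<rho>_q: "\<rho> = 1 - q / 2" by (simp add: \<rho>_def q_def)
  show "0 < \<rho>" "\<rho> < 1" using q by (simp_all add: \<rho>_q)
  have N: "0 < 1 + 2 * g + 8 * g\<^sup>2" using g by (simp add: add_pos_pos)
  have "q\<^sup>2 = (\<mu> - 2 * s) / \<mu>"
    using l by (simp add: q_def)
  also have "\<dots> = (2 * s * (16 * g\<^sup>2)) / (2 * s * (1 + 16 * g\<^sup>2))"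
    by (simp add: \<mu> algebra_simps)
  also have "\<dots> = 16 * g\<^sup>2 / (1 + 16 * g\<^sup>2)"
    using s by (intro mult_divide_mult_cancel_left) auto
  also have "\<dots> \<le> (4 * g * (1 + 2 * g) / (1 + 2 * g + 8 * g\<^sup>2))\<^sup>2"
  proof -
    have "(1 + 2 * g)\<^sup>2 * (1 + 16 * g\<^sup>2) - (1 + 2 * g + 8 * g\<^sup>2)\<^sup>2 = 32 * g ^ 3"
      by (simp add: algebra_simps eval_nat_numeral)
    then have "(1 + 2 * g + 8 * g\<^sup>2)\<^sup>2 \<le> (1 + 2 * g)\<^sup>2 * (1 + 16 * g\<^sup>2)"
      using zero_le_power[of g 3] g by linarith
    then have "16 * g\<^sup>2 * (1 + 2 * g + 8 * g\<^sup>2)\<^sup>2 \<le> 16 * g\<^sup>2 * ((1 + 2 * g)\<^sup>2 * (1 + 16 * g\<^sup>2))"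
      by (intro mult_left_mono) auto
    also have "\<dots> = (4 * g * (1 + 2 * g))\<^sup>2 * (1 + 16 * g\<^sup>2)"
      by (simp add: power2_eq_square)
    finally have "16 * g\<^sup>2 \<le> (4 * g * (1 + 2 * g))\<^sup>2 / (1 + 2 * g + 8 * g\<^sup>2)\<^sup>2 * (1 + 16 * g\<^sup>2)"
      using N by (simp only: times_divide_eq_left pos_le_divide_eq zero_less_power)
    then show ?thesis
      unfolding power_divide by (intro mult_imp_div_pos_le) (auto simp: add_pos_nonneg)
  qed
  finally have "q \<le> 4 * g * (1 + 2 * g) / (1 + 2 * g + 8 * g\<^sup>2)"
    using g N by (simp add: power2_le_iff_abs_le)
  then have "q * (1 + 2 * g + 8 * g\<^sup>2) \<le> 4 * g * (1 + 2 * g)"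
    using N by (simp add: le_divide_eq)
  then have "1 + 4 * g\<^sup>2 \<le> (1 + 2 * g + 8 * g\<^sup>2) * \<rho>"
    by (simp add: \<rho>_q algebra_simps power2_eq_square)
  moreover have "0 < growth g" using g by (simp add: growth_def add_pos_nonneg)
  ultimately have "growth g * (1 + 4 * g\<^sup>2) \<le> growth g * ((1 + 2 * g + 8 * g\<^sup>2) * \<rho>)"
    by (intro mult_left_mono) auto
  moreover have "0 < 1 + 4 * g\<^sup>2" by (simp add: add_pos_nonneg)
  ultimately show "growth g \<le> rate g * \<rho>"
    by (simp add: rate_def field_simps)
qed

text \<open>The \<open>gain\<close> part of the majorant uses \<open>\<epsilon> / 30\<close>. The
  exponential part must fit into \<open>29 / 30 * \<epsilon>\<close>, where
  \<open>h * \<rho> ^ t\<close> costs at most \<open>\<epsilon> / 2\<close> and the rest is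
  \<open>offset g * \<epsilon>\<close>; this explains the constant in
  \<open>gain_ge_rate_power\<close>.\<close>

lemma majorant_le_gain:
  assumes g: "0 < g" and \<epsilon>: "0 < \<epsilon>" and \<rho>: "0 < \<rho>" "\<rho> < 1" "growth g \<le> rate g * \<rho>"
    and h: "0 \<le> h" "2 * h * \<rho> ^ t \<le> \<epsilon>"
  shows "majorant g \<epsilon> h t \<le> \<epsilon> * gain g t"
proof -
  have o: "0 \<le> offset g" using g by (simp add: offset_def)
  have "0 < growth g" using g by (simp add: growth_def add_pos_nonneg)
  then have r: "0 < rate g * \<rho>" using \<rho> by linarith
  then have r': "0 < rate g" using \<rho> by (simp add: zero_less_mult_iff)
  have "(h + offset g * \<epsilon>) * growth g ^ t \<le> (h + offset g * \<epsilon>) * (rate g * \<rho>) ^ t"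
    using \<rho> h o \<epsilon> \<open>0 < growth g\<close> by (intro mult_left_mono power_mono) auto
  also have "\<dots> = (h * \<rho> ^ t + offset g * \<epsilon> * \<rho> ^ t) * rate g ^ t"
    by (simp add: power_mult_distrib algebra_simps)
  also have "\<dots> \<le> (\<epsilon> / 2 + offset g * \<epsilon>) * rate g ^ t"
  proof (intro mult_right_mono add_mono)
    show "offset g * \<epsilon> * \<rho> ^ t \<le> offset g * \<epsilon>"
      using \<rho> o \<epsilon> by (intro mult_left_le power_le_one) auto
  qed (use h r' in auto)
  also have "\<dots> = 29 / 30 * \<epsilon> * (30 / 29 * (1 / 2 + offset g) * rate g ^ t)"
    by (simp add: algebra_simps)
  also have "\<dots> \<le> 29 / 30 * \<epsilon> * gain g t"
    using gain_ge_rate_power[OF g] \<epsilon> by (intro mult_left_mono) auto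
  finally show ?thesis by (simp add: majorant_def)
qed

section \<open>Vector norms, extremal singular values and inverses\<close>

lemma vnorm_eq_L2_set: "vnorm v = L2_set (\<lambda>i. v $ i) {..<dim_vec v}"
  by (simp add: vnorm_def L2_set_def scalar_prod_def atLeast0LessThan power2_eq_square)

lemma vnorm_nonneg: "0 \<le> vnorm v"
  by (simp add: vnorm_eq_L2_set L2_set_nonneg)

lemma vnorm_smult: "vnorm (c \<cdot>\<^sub>v v) = \<bar>c\<bar> * vnorm v"
  by (simp add: vnorm_def real_sqrt_mult mult.assoc[symmetric])

lemma vnorm_eq_0_iff: "v \<in> carrier_vec n \<Longrightarrow> vnorm v = 0 \<longleftrightarrow> v = 0\<^sub>v n"
  by (auto simp: vnorm_eq_L2_set L2_set_eq_0_iff intro!: eq_vecI)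

lemma vnorm_normalise:
  assumes "v \<in> carrier_vec n" "v \<noteq> 0\<^sub>v n"
  obtains e where "e \<in> carrier_vec n" "vnorm e = 1" "v = vnorm v \<cdot>\<^sub>v e"
proof
  have p: "vnorm v \<noteq> 0" using assms by (simp add: vnorm_eq_0_iff)
  show "(1 / vnorm v) \<cdot>\<^sub>v v \<in> carrier_vec n" using assms by simp
  show "vnorm ((1 / vnorm v) \<cdot>\<^sub>v v) = 1"
    unfolding vnorm_smult using p vnorm_nonneg[of v] by simp
  show "v = vnorm v \<cdot>\<^sub>v ((1 / vnorm v) \<cdot>\<^sub>v v)"
    using p by (simp add: smult_smult_assoc)
qed

text \<open>A crude bound whose purpose is to make the set under the supremum in
  \<open>spec_norm\<close> bounded.\<close>

lemma vnorm_mult_mat_vec_le: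
  "vnorm (M *\<^sub>v x) \<le> (\<Sum>i<dim_row M. \<Sum>j<dim_col M. \<bar>M $$ (i, j)\<bar>) * vnorm x"
  if x: "x \<in> carrier_vec (dim_col M)"
proof -
  have "vnorm (M *\<^sub>v x) \<le> (\<Sum>i<dim_row M. \<bar>(M *\<^sub>v x) $ i\<bar>)"
    unfolding vnorm_eq_L2_set dim_mult_mat_vec by (rule L2_set_le_sum_abs)
  also have "\<dots> \<le> (\<Sum>i<dim_row M. \<Sum>j<dim_col M. \<bar>M $$ (i, j)\<bar> * vnorm x)"
  proof (rule sum_mono)
    fix i assume "i \<in> {..<dim_row M}"
    then have "(M *\<^sub>v x) $ i = (\<Sum>j<dim_col M. M $$ (i, j) * x $ j)"
      using x by (simp add: scalar_prod_def atLeast0LessThan)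
    then have "\<bar>(M *\<^sub>v x) $ i\<bar> \<le> (\<Sum>j<dim_col M. \<bar>M $$ (i, j) * x $ j\<bar>)"
      by simp
    also have "\<dots> \<le> (\<Sum>j<dim_col M. \<bar>M $$ (i, j)\<bar> * vnorm x)"
    proof (rule sum_mono)
      fix j assume "j \<in> {..<dim_col M}"
      then have "\<bar>x $ j\<bar> \<le> L2_set (\<lambda>i. \<bar>x $ i\<bar>) {..<dim_vec x}"
        using x by (intro member_le_L2_set) auto
      then show "\<bar>M $$ (i, j) * x $ j\<bar> \<le> \<bar>M $$ (i, j)\<bar> * vnorm x"
        by (simp add: abs_mult mult_left_mono vnorm_eq_L2_set L2_set_def)
    qed
    finally show "\<bar>(M *\<^sub>v x) $ i\<bar> \<le> (\<Sum>j<dim_col M. \<bar>M $$ (i, j)\<bar> * vnorm x)" .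
  qed
  finally show ?thesis by (simp add: sum_distrib_right)
qed

lemma mult_mat_vec_smult_real:
  "x \<in> carrier_vec (dim_col M) \<Longrightarrow> M *\<^sub>v (c \<cdot>\<^sub>v x) = c \<cdot>\<^sub>v (M *\<^sub>v x)" for c :: real
  by (intro mult_mat_vec) auto

lemma vnorm_mult_le_spec_norm:
  assumes M: "M \<in> carrier_mat m n" and x: "x \<in> carrier_vec n"
  shows "vnorm (M *\<^sub>v x) \<le> spec_norm M * vnorm x"
proof (cases "x = 0\<^sub>v n")
  case True
  then have "M *\<^sub>v x = 0\<^sub>v m" using M by auto
  then have "vnorm (M *\<^sub>v x) = 0" "vnorm x = 0"
    using True vnorm_eq_0_iff[of "0\<^sub>v m" m] vnorm_eq_0_iff[of "0\<^sub>v n" n] by simp_all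
  then show ?thesis by simp
next
  case False
  then obtain e where e: "e \<in> carrier_vec n" "vnorm e = 1" "x = vnorm x \<cdot>\<^sub>v e"
    using vnorm_normalise[OF x] by metis
  have "vnorm (M *\<^sub>v e) \<le> spec_norm M"
    unfolding spec_norm_def
  proof (rule cSup_upper)
    show "bdd_above {vnorm (M *\<^sub>v x) |x. x \<in> carrier_vec (dim_col M) \<and> vnorm x = 1}"
      by (rule bdd_aboveI[of _ "\<Sum>i<dim_row M. \<Sum>j<dim_col M. \<bar>M $$ (i, j)\<bar>"])
        (use vnorm_mult_mat_vec_le in fastforce)
  qed (use e M in auto)
  then have "vnorm x * vnorm (M *\<^sub>v e) \<le> vnorm x * spec_norm M"
    by (intro mult_left_mono vnorm_nonneg)
  moreover have "M *\<^sub>v x = vnorm x \<cdot>\<^sub>v (M *\<^sub>v e)"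
    using e M mult_mat_vec_smult_real[of e M "vnorm x"] by simp
  ultimately show ?thesis
    using vnorm_nonneg[of x] by (simp add: vnorm_smult mult.commute)
qed

lemma sigma_min_mult_le_vnorm:
  assumes M: "M \<in> carrier_mat m n" and x: "x \<in> carrier_vec n"
  shows "sigma_min M * vnorm x \<le> vnorm (M *\<^sub>v x)"
proof (cases "x = 0\<^sub>v n")
  case True
  then have "vnorm x = 0" using vnorm_eq_0_iff[of "0\<^sub>v n" n] by simp
  then show ?thesis by (simp add: vnorm_nonneg)
next
  case False
  then obtain e where e: "e \<in> carrier_vec n" "vnorm e = 1" "x = vnorm x \<cdot>\<^sub>v e"
    using vnorm_normalise[OF x] by metis
  have "sigma_min M \<le> vnorm (M *\<^sub>v e)"
    unfolding sigma_min_def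
  proof (rule cInf_lower)
    show "bdd_below {vnorm (M *\<^sub>v x) |x. x \<in> carrier_vec (dim_col M) \<and> vnorm x = 1}"
      by (rule bdd_belowI[of _ 0]) (auto simp: vnorm_nonneg)
  qed (use e M in auto)
  then have "vnorm x * sigma_min M \<le> vnorm x * vnorm (M *\<^sub>v e)"
    by (intro mult_left_mono vnorm_nonneg)
  moreover have "M *\<^sub>v x = vnorm x \<cdot>\<^sub>v (M *\<^sub>v e)"
    using e M mult_mat_vec_smult_real[of e M "vnorm x"] by simp
  ultimately show ?thesis
    using vnorm_nonneg[of x] by (simp add: vnorm_smult mult.commute)
qed

lemma le_sigma_min:
  assumes M: "M \<in> carrier_mat m n" "0 < n"
    and le: "\<And>x. x \<in> carrier_vec n \<Longrightarrow> vnorm x = 1 \<Longrightarrow> c \<le> vnorm (M *\<^sub>v x)"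
  shows "c \<le> sigma_min M"
  unfolding sigma_min_def
proof (rule cInf_greatest)
  have "vnorm (unit_vec n 0) = 1"
    using M by (simp add: vnorm_def)
  then show "{vnorm (M *\<^sub>v x) |x. x \<in> carrier_vec (dim_col M) \<and> vnorm x = 1} \<noteq> {}"
    using M by (auto intro!: exI[of _ "unit_vec n 0"])
qed (use M le in auto)

lemma mat_inv_left:
  assumes R: "R \<in> carrier_mat n n"
    and inj: "\<And>v. v \<in> carrier_vec n \<Longrightarrow> R *\<^sub>v v = 0\<^sub>v n \<Longrightarrow> v = 0\<^sub>v n"
  shows "mat_inv R \<in> carrier_mat n n" "mat_inv R * R = 1\<^sub>m n" "R * mat_inv R = 1\<^sub>m n"
proof -
  have "Determinant.det R \<noteq> 0"
    using det_0_iff_vec_prod_zero_field[OF R] inj by blast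
  then obtain B where "B \<in> carrier_mat n n" "B * R = 1\<^sub>m n" "R * B = 1\<^sub>m n"
    using det_non_zero_imp_unit[OF R, where b = "()"] by (auto simp: Units_def ring_mat_def)
  then have "\<exists>B. inverts_mat R B \<and> inverts_mat B R"
    using R by (intro exI[of _ B]) (simp add: inverts_mat_def)
  then have inv: "inverts_mat R (mat_inv R)" "inverts_mat (mat_inv R) R"
    unfolding mat_inv_def by (metis (mono_tags, lifting) someI_ex)+
  \<comment> \<open>The choice in \<open>mat_inv\<close> fixes no dimensions; they are read off from
    the column counts of the two products.\<close>
  have "dim_col (mat_inv R) = n"
    using arg_cong[OF inv(1)[unfolded inverts_mat_def], of dim_col] R by simp
  moreover have "dim_row (mat_inv R) = n"
    using arg_cong[OF inv(2)[unfolded inverts_mat_def], of dim_col] R by simp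
  ultimately show "mat_inv R \<in> carrier_mat n n" by (rule carrier_matI[rotated])
  then show "mat_inv R * R = 1\<^sub>m n" "R * mat_inv R = 1\<^sub>m n"
    using inv R by (auto simp: inverts_mat_def)
qed

section \<open>Orthonormal columns and eigenbasis coordinates\<close>

lemma vnorm_stiefel:
  assumes "X \<in> stiefel d k" "y \<in> carrier_vec k"
  shows "vnorm (X *\<^sub>v y) = vnorm y"
proof -
  have X: "X \<in> carrier_mat d k" "transpose_mat X * X = 1\<^sub>m k"
    using assms by (auto simp: stiefel_def)
  have "(X *\<^sub>v y) \<bullet> (X *\<^sub>v y) = (transpose_mat X *\<^sub>v (X *\<^sub>v y)) \<bullet> y"
    using X assms by (intro transpose_vec_mult_scalar[symmetric]) auto
  also have "transpose_mat X *\<^sub>v (X *\<^sub>v y) = (transpose_mat X * X) *\<^sub>v y"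
    using X assms by (intro assoc_mult_mat_vec[symmetric]) auto
  finally show ?thesis
    using X assms by (simp add: vnorm_def)
qed

lemma vnorm_transpose_mat_of_cols:
  fixes u :: "nat \<Rightarrow> real vec"
  assumes u: "\<And>i. i < d \<Longrightarrow> u i \<in> carrier_vec d" and "b \<le> d"
  shows "vnorm (transpose_mat (mat_of_cols d (map u [a..<b])) *\<^sub>v y)
    = L2_set (\<lambda>i. u i \<bullet> y) {a..<b}"
proof -
  let ?M = "transpose_mat (mat_of_cols d (map u [a..<b]))"
  have "(?M *\<^sub>v y) $ i = u (a + i) \<bullet> y" if "i < b - a" for i
    using that assms by simp
  then have "vnorm (?M *\<^sub>v y) = L2_set (\<lambda>i. u (a + i) \<bullet> y) {..<b - a}"
    unfolding vnorm_eq_L2_set by (intro L2_set_cong) auto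
  also have "\<dots> = L2_set (\<lambda>i. u i \<bullet> y) {a..<b}"
    unfolding L2_set_def
    by (simp add: sum.atLeastLessThan_shift_0[of _ a b] atLeast0LessThan)
  finally show ?thesis .
qed

text \<open>Parseval: a left inverse of a square matrix is a right inverse, so the transposed
  eigenbasis also has orthonormal columns.\<close>

lemma L2_set_orthonormal_coords:
  fixes u :: "nat \<Rightarrow> real vec"
  assumes u: "\<And>i. i < d \<Longrightarrow> u i \<in> carrier_vec d"
    and orth: "\<And>i j. i < d \<Longrightarrow> j < d \<Longrightarrow> u i \<bullet> u j = (if i = j then 1 else 0 :: real)"
    and y: "y \<in> carrier_vec d"
  shows "L2_set (\<lambda>i. u i \<bullet> y) {0..<d} = vnorm y"
proof -
  let ?U = "mat_of_cols d (map u [0..<d])"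
  have U: "?U \<in> carrier_mat d d" by (simp add: mat_of_cols_def)
  have "transpose_mat ?U * ?U = 1\<^sub>m d"
    by (rule eq_matI) (use u orth in auto)
  then have UU: "?U * transpose_mat ?U = 1\<^sub>m d"
    using U by (intro mat_mult_left_right_inverse[where A = "transpose_mat ?U"]) auto
  have "transpose_mat ?U \<in> stiefel d d"
    using U UU by (simp add: stiefel_def)
  from vnorm_stiefel[OF this y] show ?thesis
    using vnorm_transpose_mat_of_cols[of d u d 0 y] u by simp
qed

lemma L2_set_disjoint_union:
  assumes "finite I" "finite J" "I \<inter> J = {}"
  shows "(L2_set h (I \<union> J))\<^sup>2 = (L2_set h I)\<^sup>2 + (L2_set h J)\<^sup>2"
  using assms by (simp add: L2_set_def sum_nonneg sum.union_disjoint)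

lemma stiefel_coords_norm:
  fixes u :: "nat \<Rightarrow> real vec"
  assumes u: "\<And>i. i < d \<Longrightarrow> u i \<in> carrier_vec d"
    and orth: "\<And>i j. i < d \<Longrightarrow> j < d \<Longrightarrow> u i \<bullet> u j = (if i = j then 1 else 0 :: real)"
    and X: "X \<in> stiefel d k" and y: "y \<in> carrier_vec k" and "m \<le> d"
  shows "(L2_set (\<lambda>i. u i \<bullet> (X *\<^sub>v y)) {0..<m})\<^sup>2 + (L2_set (\<lambda>i. u i \<bullet> (X *\<^sub>v y)) {m..<d})\<^sup>2
    = (vnorm y)\<^sup>2"
proof -
  have "X *\<^sub>v y \<in> carrier_vec d" using X y by (auto simp: stiefel_def)
  then have "L2_set (\<lambda>i. u i \<bullet> (X *\<^sub>v y)) {0..<d} = vnorm (X *\<^sub>v y)"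
    using u orth by (intro L2_set_orthonormal_coords) auto
  moreover have "{0..<m} \<union> {m..<d} = {0..<d}" using \<open>m \<le> d\<close> by auto
  ultimately show ?thesis
    using L2_set_disjoint_union[of "{0..<m}" "{m..<d}" "\<lambda>i. u i \<bullet> (X *\<^sub>v y)"] vnorm_stiefel[OF X y]
    by simp
qed

lemma scalar_prod_eigenvector:
  fixes A :: "real mat"
  assumes A: "A \<in> carrier_mat d d" "transpose_mat A = A"
    and v: "v \<in> carrier_vec d" "A *\<^sub>v v = l \<cdot>\<^sub>v v" and y: "y \<in> carrier_vec d"
  shows "v \<bullet> (A *\<^sub>v y) = l * (v \<bullet> y)"
  using transpose_vec_mult_scalar[OF A(1) y v(1)] A v y by simp

section \<open>The iteration in eigenbasis coordinates\<close>

text \<open>Angles and operator norms enter only as inequalities for all test vectors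
  \<open>y\<close>. Invertibility of the factors \<open>R (Suc t)\<close> is not assumed; it is
  derived in \<open>R_injective\<close>.\<close>

locale accelerated_power_iteration =
  fixes d k :: nat and A :: "real mat" and lam :: "nat \<Rightarrow> real" and u :: "nat \<Rightarrow> real vec"
    and X R \<Xi> :: "nat \<Rightarrow> real mat" and s g \<epsilon> :: real
  assumes kd: "k \<le> d"
    and s: "0 < s" and g: "0 < g" and \<epsilon>: "0 < \<epsilon>" "\<epsilon> < 1"
    and A: "A \<in> carrier_mat d d" "transpose_mat A = A"
    and u: "i < d \<Longrightarrow> u i \<in> carrier_vec d"
    and orth: "i < d \<Longrightarrow> j < d \<Longrightarrow> u i \<bullet> u j = (if i = j then 1 else 0)"
    and eig: "i < d \<Longrightarrow> A *\<^sub>v u i = lam i \<cdot>\<^sub>v u i"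
    and lam_top: "i < k \<Longrightarrow> s * (2 + 32 * g\<^sup>2) \<le> lam i"
    and lam_rest: "k \<le> i \<Longrightarrow> i < d \<Longrightarrow> \<bar>lam i\<bar> \<le> 2 * s"
    and X: "X t \<in> stiefel d k"
    and R: "R (Suc t) \<in> carrier_mat k k"
    and \<Xi>: "\<Xi> t \<in> carrier_mat d k"
    and step_0: "X 1 * R 1 = (1/2) \<cdot>\<^sub>m (A * X 0) + \<Xi> 0"
    and step_Suc: "X (Suc (Suc t)) * R (Suc (Suc t))
      = A * X (Suc t) - s\<^sup>2 \<cdot>\<^sub>m (X t * mat_inv (R (Suc t))) + \<Xi> (Suc t)"
    and noise_top: "y \<in> carrier_vec k \<Longrightarrow> L2_set (\<lambda>i. u i \<bullet> (\<Xi> t *\<^sub>v y)) {0..<k}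
      \<le> s * g\<^sup>2 * L2_set (\<lambda>i. u i \<bullet> (X t *\<^sub>v y)) {0..<k}"
    and noise_rest: "y \<in> carrier_vec k \<Longrightarrow> L2_set (\<lambda>i. u i \<bullet> (\<Xi> t *\<^sub>v y)) {k..<d}
      \<le> s * g\<^sup>2 * \<epsilon> * vnorm y"
    and start: "y \<in> carrier_vec k \<Longrightarrow> y \<noteq> 0\<^sub>v k \<Longrightarrow> 0 < L2_set (\<lambda>i. u i \<bullet> (X 0 *\<^sub>v y)) {0..<k}"
begin

lemma X_carrier: "X t \<in> carrier_mat d k"
  using X by (simp add: stiefel_def)

fun push :: "real vec \<Rightarrow> nat \<Rightarrow> real vec" where
  "push x 0 = x"
| "push x (Suc t) = R (Suc t) *\<^sub>v push x t"

lemma push_carrier: "x \<in> carrier_vec k \<Longrightarrow> push x t \<in> carrier_vec k"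
  by (induction t) (auto intro: mult_mat_vec_carrier[OF R])

definition coord :: "real vec \<Rightarrow> nat \<Rightarrow> nat \<Rightarrow> real" where
  "coord x t i = u i \<bullet> (X t *\<^sub>v push x t)"

definition noise :: "real vec \<Rightarrow> nat \<Rightarrow> nat \<Rightarrow> real" where
  "noise x t i = u i \<bullet> (\<Xi> t *\<^sub>v push x t)"

lemma smult_mat_mult_vec:
  "M \<in> carrier_mat m n \<Longrightarrow> v \<in> carrier_vec n \<Longrightarrow> (c \<cdot>\<^sub>m M) *\<^sub>v v = c \<cdot>\<^sub>v (M *\<^sub>v v)" for c :: real
  by (intro eq_vecI) auto

lemma coord_1:
  assumes x: "x \<in> carrier_vec k" and i: "i < d"
  shows "coord x 1 i = lam i / 2 * coord x 0 i + noise x 0 i"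
proof -
  note X0 = X_carrier[of 0] and X1 = X_carrier[of 1]
  have "X 1 *\<^sub>v (R 1 *\<^sub>v x) = (X 1 * R 1) *\<^sub>v x"
    using X1 R[of 0] x by simp
  also have "\<dots> = (1/2) \<cdot>\<^sub>v (A *\<^sub>v (X 0 *\<^sub>v x)) + \<Xi> 0 *\<^sub>v x"
    unfolding step_0 using X0 A \<Xi>[of 0] x
    by (subst add_mult_distrib_mat_vec[of _ d k]) (auto simp: smult_mat_mult_vec[of _ d k])
  finally have "coord x 1 i = u i \<bullet> ((1/2) \<cdot>\<^sub>v (A *\<^sub>v (X 0 *\<^sub>v x)) + \<Xi> 0 *\<^sub>v x)"
    by (simp add: coord_def)
  also have "\<dots> = 1/2 * (u i \<bullet> (A *\<^sub>v (X 0 *\<^sub>v x))) + u i \<bullet> (\<Xi> 0 *\<^sub>v x)"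
    using X0 A \<Xi>[of 0] x u[OF i] by (subst scalar_prod_add_distrib[of _ d]) auto
  also have "u i \<bullet> (A *\<^sub>v (X 0 *\<^sub>v x)) = lam i * (u i \<bullet> (X 0 *\<^sub>v x))"
    using X0 x by (intro scalar_prod_eigenvector[OF A u[OF i] eig[OF i]]) auto
  finally show ?thesis by (simp add: coord_def noise_def)
qed

text \<open>On \<open>push x (Suc t)\<close> the inverse in the momentum term returns
  \<open>push x t\<close>, which makes the recurrence linear. Injectivity is a hypothesis because
  \<open>R_injective\<close> uses this lemma inside its induction.\<close>

lemma coord_Suc_Suc:
  assumes x: "x \<in> carrier_vec k" and i: "i < d"
    and inj: "\<And>v. v \<in> carrier_vec k \<Longrightarrow> R (Suc t) *\<^sub>v v = 0\<^sub>v k \<Longrightarrow> v = 0\<^sub>v k"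
  shows "coord x (Suc (Suc t)) i = lam i * coord x (Suc t) i - s\<^sup>2 * coord x t i + noise x (Suc t) i"
proof -
  note X0 = X_carrier[of t] and X1 = X_carrier[of "Suc t"] and X2 = X_carrier[of "Suc (Suc t)"]
  have inv: "mat_inv (R (Suc t)) \<in> carrier_mat k k" "mat_inv (R (Suc t)) * R (Suc t) = 1\<^sub>m k"
    using mat_inv_left[OF R[of t]] inj by blast+
  define p where "p = push x t"
  define y where "y = push x (Suc t)"
  have p: "p \<in> carrier_vec k" and y: "y \<in> carrier_vec k"
    using push_carrier[OF x] by (simp_all only: p_def y_def)
  have py: "mat_inv (R (Suc t)) *\<^sub>v y = p"
  proof -
    have "mat_inv (R (Suc t)) *\<^sub>v y = (mat_inv (R (Suc t)) * R (Suc t)) *\<^sub>v p"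
      using inv(1) R[of t] p by (simp add: y_def p_def)
    then show ?thesis using inv(2) p by simp
  qed
  have "X (Suc (Suc t)) *\<^sub>v (R (Suc (Suc t)) *\<^sub>v y) = (X (Suc (Suc t)) * R (Suc (Suc t))) *\<^sub>v y"
    using X2 R[of "Suc t"] y by simp
  also have "\<dots> = (A * X (Suc t)) *\<^sub>v y - (s\<^sup>2 \<cdot>\<^sub>m (X t * mat_inv (R (Suc t)))) *\<^sub>v y + \<Xi> (Suc t) *\<^sub>v y"
  proof -
    have C: "A * X (Suc t) \<in> carrier_mat d k" "s\<^sup>2 \<cdot>\<^sub>m (X t * mat_inv (R (Suc t))) \<in> carrier_mat d k"
      using A X1 X0 inv(1) by simp_all
    show ?thesis
      unfolding step_Suc add_mult_distrib_mat_vec[OF minus_carrier_mat[OF C(2)] \<Xi> y]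
        minus_mult_distrib_mat_vec[OF C y] ..
  qed
  also have "(s\<^sup>2 \<cdot>\<^sub>m (X t * mat_inv (R (Suc t)))) *\<^sub>v y = s\<^sup>2 \<cdot>\<^sub>v (X t *\<^sub>v p)"
    using X0 inv(1) y by (simp add: smult_mat_mult_vec[of _ d k] py)
  also have "(A * X (Suc t)) *\<^sub>v y = A *\<^sub>v (X (Suc t) *\<^sub>v y)"
    using X1 A y by simp
  finally have "coord x (Suc (Suc t)) i
      = u i \<bullet> (A *\<^sub>v (X (Suc t) *\<^sub>v y) - s\<^sup>2 \<cdot>\<^sub>v (X t *\<^sub>v p) + \<Xi> (Suc t) *\<^sub>v y)"
    by (simp add: coord_def y_def)
  also have "\<dots> = u i \<bullet> (A *\<^sub>v (X (Suc t) *\<^sub>v y)) - s\<^sup>2 * (u i \<bullet> (X t *\<^sub>v p)) + u i \<bullet> (\<Xi> (Suc t) *\<^sub>v y)"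
    using X0 X1 A \<Xi>[of "Suc t"] p y u[OF i]
    by (subst scalar_prod_add_distrib[of _ d], simp_all)
       (subst scalar_prod_minus_distrib[of _ d], simp_all)
  also have "u i \<bullet> (A *\<^sub>v (X (Suc t) *\<^sub>v y)) = lam i * (u i \<bullet> (X (Suc t) *\<^sub>v y))"
    using X1 y by (intro scalar_prod_eigenvector[OF A u[OF i] eig[OF i]]) auto
  finally show ?thesis by (simp add: coord_def noise_def p_def y_def)
qed

lemma noise_top_le:
  "x \<in> carrier_vec k \<Longrightarrow> L2_set (noise x t) {0..<k} \<le> s * g\<^sup>2 * L2_set (coord x t) {0..<k}"
  unfolding noise_def coord_def by (intro noise_top push_carrier)

lemma noise_rest_le:
  assumes x: "x \<in> carrier_vec k"
  shows "L2_set (noise x t) {k..<d}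
    \<le> s * g\<^sup>2 * (\<epsilon> * L2_set (coord x t) {0..<k} + L2_set (coord x t) {k..<d})"
proof -
  let ?a = "L2_set (coord x t) {0..<k}" and ?b = "L2_set (coord x t) {k..<d}"
  have nn: "0 \<le> ?a" "0 \<le> ?b" by (simp_all add: L2_set_nonneg)
  have "L2_set (noise x t) {k..<d} \<le> s * g\<^sup>2 * \<epsilon> * vnorm (push x t)"
    unfolding noise_def by (intro noise_rest push_carrier x)
  also have "(vnorm (push x t))\<^sup>2 = ?a\<^sup>2 + ?b\<^sup>2"
    unfolding coord_def by (rule stiefel_coords_norm[symmetric]) (use u orth X push_carrier[OF x] kd in auto)
  then have "(vnorm (push x t))\<^sup>2 \<le> (?a + ?b)\<^sup>2"
    using nn by (simp add: power2_sum)
  then have "vnorm (push x t) \<le> ?a + ?b"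
    by (rule power2_le_imp_le) (use nn in simp)
  then have "s * g\<^sup>2 * \<epsilon> * vnorm (push x t) \<le> s * g\<^sup>2 * \<epsilon> * (?a + ?b)"
    using s \<epsilon> by (intro mult_left_mono) auto
  \<comment> \<open>The factor \<epsilon> is kept only on the dominant part; on \<open>?b\<close> it
    is bounded by 1.\<close>
  also have "\<dots> \<le> s * g\<^sup>2 * (\<epsilon> * ?a + 1 * ?b)"
    unfolding mult.assoc distrib_left[of \<epsilon>]
    using s \<epsilon> nn by (intro mult_left_mono add_left_mono mult_right_mono) auto
  finally show ?thesis by simp
qed

text \<open>If the earlier factors are invertible, a kernel vector \<open>v\<close> equals
  \<open>push x t\<close> for some \<open>x\<close>. Then all dominant coordinates vanish at time
  \<open>Suc t\<close>, which the growth estimate forbids unless \<open>x = 0\<close>.\<close>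

lemma R_injective:
  assumes "v \<in> carrier_vec k" "R (Suc t) *\<^sub>v v = 0\<^sub>v k"
  shows "v = 0\<^sub>v k"
  using assms
proof (induction t arbitrary: v rule: less_induct)
  case (less t)
  have onto: "\<exists>x\<in>carrier_vec k. push x r = y" if "r \<le> t" "y \<in> carrier_vec k" for r y
    using that
  proof (induction r arbitrary: y)
    case (Suc r)
    have inv: "mat_inv (R (Suc r)) \<in> carrier_mat k k" "R (Suc r) * mat_inv (R (Suc r)) = 1\<^sub>m k"
      using mat_inv_left[OF R[of r]] less.IH[of r] Suc.prems by (meson Suc_le_lessD)+
    then obtain x where x: "x \<in> carrier_vec k" "push x r = mat_inv (R (Suc r)) *\<^sub>v y"
      using Suc by (metis Suc_leD mult_mat_vec_carrier)
    then have "push x (Suc r) = (R (Suc r) * mat_inv (R (Suc r))) *\<^sub>v y"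
      using inv(1) R[of r] Suc.prems by simp
    also have "\<dots> = y" using inv(2) Suc.prems by simp
    finally show ?case using x(1) by blast
  qed auto
  from onto[of t v] less.prems obtain x where x: "x \<in> carrier_vec k" "push x t = v" by auto
  have grow: "s * gain g (Suc r) * L2_set (coord x r) {0..<k}
      \<le> gain g r * L2_set (coord x (Suc r)) {0..<k}" if "r \<le> t" for r
  \<comment> \<open>Up to time \<open>Suc t\<close> the recurrence inverts only
    \<open>R (Suc r)\<close> with \<open>r < t\<close>, which the induction hypothesis
    covers.\<close>
  proof (rule momentum_recurrence_growth[where n = "Suc t" and f = "noise x" and lam = lam])
    show "coord x (Suc (Suc r)) i = lam i * coord x (Suc r) i - s\<^sup>2 * coord x r i + noise x (Suc r) i"
      if "i \<in> {0..<k}" "Suc r < Suc t" for r i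
      using that kd less.IH[of r] by (intro coord_Suc_Suc x) auto
  qed (use that s kd x lam_top coord_1 noise_top_le in auto)
  have pos: "r \<le> Suc t \<Longrightarrow> x \<noteq> 0\<^sub>v k \<Longrightarrow> 0 < L2_set (coord x r) {0..<k}" for r
  proof (induction r)
    case 0
    then show ?case using start[OF x(1)] by (simp add: coord_def)
  next
    case (Suc r)
    then have "0 < s * gain g (Suc r) * L2_set (coord x r) {0..<k}"
      using s gain_pos by simp
    then have "0 < gain g r * L2_set (coord x (Suc r)) {0..<k}"
      using grow[of r] Suc.prems by linarith
    then show ?case using gain_pos[of g r] by (simp add: zero_less_mult_iff)
  qed
  have "coord x (Suc t) i = 0" if "i \<in> {0..<k}" for i
  proof -
    have "X (Suc t) *\<^sub>v 0\<^sub>v k = 0\<^sub>v d"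
      using X_carrier[of "Suc t"] by auto
    then show ?thesis
      using that kd u less.prems x by (simp add: coord_def)
  qed
  then have "L2_set (coord x (Suc t)) {0..<k} = 0"
    by (simp add: L2_set_eq_0_iff)
  then have "x = 0\<^sub>v k" using pos[of "Suc t"] by auto
  moreover have "R (Suc r) *\<^sub>v 0\<^sub>v k = 0\<^sub>v k" for r
    using R[of r] by auto
  then have "push (0\<^sub>v k) r = 0\<^sub>v k" for r
    by (induction r) simp_all
  ultimately show ?case using x by simp
qed

lemma push_onto:
  assumes "y \<in> carrier_vec k"
  obtains x where "x \<in> carrier_vec k" "push x t = y"
proof -
  have "\<exists>x\<in>carrier_vec k. push x t = y"
    using assms
  proof (induction t arbitrary: y)
    case (Suc t)
    have inv: "mat_inv (R (Suc t)) \<in> carrier_mat k k" "R (Suc t) * mat_inv (R (Suc t)) = 1\<^sub>m k"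
      using mat_inv_left[OF R[of t]] R_injective by blast+
    obtain x where x: "x \<in> carrier_vec k" "push x t = mat_inv (R (Suc t)) *\<^sub>v y"
      using Suc inv(1) by (metis mult_mat_vec_carrier)
    then have "push x (Suc t) = (R (Suc t) * mat_inv (R (Suc t))) *\<^sub>v y"
      using inv(1) R[of t] Suc.prems by simp
    also have "\<dots> = y" using inv(2) Suc.prems by simp
    finally show ?case using x(1) by blast
  qed auto
  then show ?thesis using that by blast
qed

text \<open>Since \<open>push\<close> is onto, every \<open>y\<close> is the endpoint of a linear
  trajectory, to which the quotient estimate applies.\<close>

lemma tangent_le:
  assumes h: "0 \<le> h" and y: "y \<in> carrier_vec k"
    and init: "\<And>x. x \<in> carrier_vec k \<Longrightarrow>
      L2_set (\<lambda>i. u i \<bullet> (X 0 *\<^sub>v x)) {k..<d} \<le> h * L2_set (\<lambda>i. u i \<bullet> (X 0 *\<^sub>v x)) {0..<k}"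
  shows "L2_set (\<lambda>i. u i \<bullet> (X t *\<^sub>v y)) {k..<d} * gain g t
    \<le> majorant g \<epsilon> h t * L2_set (\<lambda>i. u i \<bullet> (X t *\<^sub>v y)) {0..<k}"
proof -
  obtain x where x: "x \<in> carrier_vec k" "push x t = y"
    using push_onto[OF y] .
  have "L2_set (coord x t) {k..<d} * gain g t \<le> majorant g \<epsilon> h t * L2_set (coord x t) {0..<k}"
  proof (rule momentum_recurrence_ratio_le[where lam = lam and f = "noise x"])
    show "coord x 1 i = lam i / 2 * coord x 0 i + noise x 0 i" if "i \<in> {0..<k} \<union> {k..<d}" for i
      using that kd by (intro coord_1 x) auto
    show "coord x (Suc (Suc t)) i = lam i * coord x (Suc t) i - s\<^sup>2 * coord x t i + noise x (Suc t) i"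
      if "i \<in> {0..<k} \<union> {k..<d}" for t i
      using that kd R_injective by (intro coord_Suc_Suc x) auto
    show "L2_set (coord x 0) {k..<d} \<le> h * L2_set (coord x 0) {0..<k}"
      using init[OF x(1)] by (simp add: coord_def[abs_def])
  qed (use s g \<epsilon> h lam_top lam_rest noise_top_le noise_rest_le x in auto)
  then show ?thesis by (simp add: coord_def[abs_def] x)
qed

end

section \<open>From principal angles to coordinate inequalities and back\<close>

theorem theorem1:
  fixes d k :: nat and \<epsilon> \<beta> :: real
    and A :: "real mat" and lam :: "nat \<Rightarrow> real" and u :: "nat \<Rightarrow> real vec"
    and X R \<Xi> :: "nat \<Rightarrow> real mat"
  defines "Uk \<equiv> mat_of_cols d (map u [0..<k])"
      and "Umk \<equiv> mat_of_cols d (map u [k..<d])"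
      and "c \<equiv> (1/32 :: real)"
  assumes dk: "d > k" and k1: "k \<ge> 1"
    and eps: "0 < \<epsilon>" "\<epsilon> < 1"
    and A_carrier: "A \<in> carrier_mat d d"
    and A_sym: "transpose_mat A = A"
    and A_psd: "\<forall>x \<in> carrier_vec d. x \<bullet> (A *\<^sub>v x) \<ge> 0"
    and u_dim: "\<forall>i < d. u i \<in> carrier_vec d"
    and u_orth: "\<forall>i < d. \<forall>j < d. u i \<bullet> u j = (if i = j then 1 else 0)"
    and eig: "\<forall>i < d. A *\<^sub>v u i = lam i \<cdot>\<^sub>v u i"
    and lam_sorted: "\<forall>i j. i \<le> j \<longrightarrow> j < d \<longrightarrow> lam j \<le> lam i"
    and lam_nonneg: "\<forall>i < d. lam i \<ge> 0"
    and gap: "lam (k - 1) > lam k"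
    and X0: "X 0 \<in> stiefel d k"
    and cos0: "cos (theta_k Uk (X 0)) > 0"
    and beta: "\<beta> > 0" "lam (k - 1) > 2 * sqrt \<beta>" "2 * sqrt \<beta> \<ge> lam k"
    and Xi_dim: "\<forall>t. \<Xi> t \<in> carrier_mat d k"
    and step1: "is_QR ((1/2) \<cdot>\<^sub>m (A * X 0) + \<Xi> 0) (X 1) (R 1)"
    and stept: "\<forall>t \<ge> 1. is_QR (A * X t - \<beta> \<cdot>\<^sub>m (X (t - 1) * mat_inv (R t)) + \<Xi> t)
                                (X (t + 1)) (R (t + 1))"
    and pert1: "\<forall>t. spec_norm (transpose_mat Umk * \<Xi> t) \<le> c * (lam (k - 1) - 2 * sqrt \<beta>) * \<epsilon>"
    and pert2: "\<forall>t. spec_norm (transpose_mat Uk * \<Xi> t)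
                   \<le> c * (lam (k - 1) - 2 * sqrt \<beta>) * cos (theta_k Uk (X t))"
  shows "\<forall>t::nat. real t \<ge>
            ln (2 * tan (theta_k Uk (X 0)) / \<epsilon>)
              / (- ln (1 - (1/2) * sqrt ((lam (k - 1) - 2 * sqrt \<beta>) / lam (k - 1))))
          \<longrightarrow> sin (theta_k Uk (X t)) \<le> \<epsilon>"
proof (intro allI impI)
  define s where "s = sqrt \<beta>"
  define \<mu> where "\<mu> = lam (k - 1)"
  \<comment> \<open>Solves \<open>\<mu> = s * (2 + 32 * g^2)\<close>; with \<open>c = 1 / 32\<close>
    the noise level becomes \<open>s * g^2\<close>.\<close>
  define g where "g = sqrt ((\<mu> - 2 * s) / (32 * s))"
  define \<rho> where "\<rho> = 1 - 1 / 2 * sqrt ((\<mu> - 2 * s) / \<mu>)"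
  define h where "h = tan (theta_k Uk (X 0))"
  have s: "0 < s" "s\<^sup>2 = \<beta>" using beta by (simp_all add: s_def)
  have gap': "0 < \<mu> - 2 * s" using beta by (simp add: s_def \<mu>_def)
  then have g: "0 < g" using s by (simp add: g_def)
  have g2: "g\<^sup>2 = (\<mu> - 2 * s) / (32 * s)" using gap' s by (simp add: g_def)
  have \<mu>: "\<mu> = s * (2 + 32 * g\<^sup>2)" and "c * (\<mu> - 2 * s) = s * g\<^sup>2"
    using s by (simp_all add: g2 c_def field_simps)
  then have \<delta>: "c * (lam (k - 1) - 2 * sqrt \<beta>) = s * g\<^sup>2"
    by (simp only: \<mu>_def s_def)
  note \<rho> = inverse_rate_le[OF g s(1) \<mu>, folded \<rho>_def]
  have QR_1: "X 1 \<in> stiefel d k" "R 1 \<in> carrier_mat k k"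
      "X 1 * R 1 = (1/2) \<cdot>\<^sub>m (A * X 0) + \<Xi> 0"
    using step1 Xi_dim[rule_format, of 0] by (auto simp: is_QR_def)
  have QR_Suc: "X (Suc (Suc t)) \<in> stiefel d k" "R (Suc (Suc t)) \<in> carrier_mat k k"
      "X (Suc (Suc t)) * R (Suc (Suc t))
        = A * X (Suc t) - s\<^sup>2 \<cdot>\<^sub>m (X t * mat_inv (R (Suc t))) + \<Xi> (Suc t)" for t
    using stept[rule_format, of "Suc t"] Xi_dim[rule_format, of "Suc t"] by (auto simp: is_QR_def s(2))
  have "X (Suc t) \<in> stiefel d k" for t
    by (cases t) (use QR_1 QR_Suc in auto)
  then have X: "X t \<in> stiefel d k" for t
    by (cases t) (use X0 in auto)
  have R: "R (Suc t) \<in> carrier_mat k k" for t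
    by (cases t) (use QR_1 QR_Suc in auto)
  have X_carrier: "X t \<in> carrier_mat d k" for t
    using X by (simp add: stiefel_def)
  define a b where "a t y = L2_set (\<lambda>i. u i \<bullet> (X t *\<^sub>v y)) {0..<k}"
    and "b t y = L2_set (\<lambda>i. u i \<bullet> (X t *\<^sub>v y)) {k..<d}" for t y
  have Uk: "Uk \<in> carrier_mat d k" and Umk: "Umk \<in> carrier_mat d (d - k)"
    unfolding Uk_def Umk_def by (simp_all add: mat_of_cols_def)
  have top: "vnorm ((transpose_mat Uk * M) *\<^sub>v y) = L2_set (\<lambda>i. u i \<bullet> (M *\<^sub>v y)) {0..<k}"
    and rest: "vnorm ((transpose_mat Umk * M) *\<^sub>v y) = L2_set (\<lambda>i. u i \<bullet> (M *\<^sub>v y)) {k..<d}"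
    if "M \<in> carrier_mat d k" "y \<in> carrier_vec k" for M y
    using vnorm_transpose_mat_of_cols[of d u k 0 "M *\<^sub>v y"]
      vnorm_transpose_mat_of_cols[of d u d k "M *\<^sub>v y"] that Uk Umk u_dim dk
    by (simp_all add: Uk_def[symmetric] Umk_def[symmetric])
  have split: "(a t y)\<^sup>2 + (b t y)\<^sup>2 = (vnorm y)\<^sup>2" if "y \<in> carrier_vec k" for t y
    unfolding a_def b_def by (rule stiefel_coords_norm) (use u_dim u_orth X that dk in auto)
  have nn: "0 \<le> a t y" "0 \<le> b t y" for t y
    by (simp_all add: a_def b_def L2_set_nonneg)
  define \<sigma> where "\<sigma> t = sigma_min (transpose_mat Uk * X t)" for t
  have M: "transpose_mat Uk * X t \<in> carrier_mat k k" for t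
    using Uk X_carrier[of t] by simp
  have \<sigma>_le: "\<sigma> t * vnorm y \<le> a t y" if "y \<in> carrier_vec k" for t y
    using sigma_min_mult_le_vnorm[OF M that] top[OF X_carrier that]
    by (simp add: \<sigma>_def a_def)
  have le_\<sigma>: "r \<le> \<sigma> t" if "\<And>y. y \<in> carrier_vec k \<Longrightarrow> vnorm y = 1 \<Longrightarrow> r \<le> a t y" for r t
    unfolding \<sigma>_def using k1 that top[OF X_carrier] by (intro le_sigma_min[OF M]) (auto simp: a_def)
  have \<sigma>_0: "0 \<le> \<sigma> t" for t
    using nn by (intro le_\<sigma>) auto
  \<comment> \<open>Both bounds on \<open>\<sigma> t\<close> are needed to undo
    \<open>arccos\<close>. The witness is a unit vector, whose image has norm 1.\<close>
  have \<sigma>_1: "\<sigma> t \<le> 1" for t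
  proof -
    have "vnorm (unit_vec k 0) = 1" using k1 by (simp add: vnorm_def)
    then have "\<sigma> t \<le> a t (unit_vec k 0)" "(a t (unit_vec k 0))\<^sup>2 + (b t (unit_vec k 0))\<^sup>2 = 1"
      using \<sigma>_le[of "unit_vec k 0" t] split[of "unit_vec k 0" t] by auto
    moreover from this(2) have "(a t (unit_vec k 0))\<^sup>2 \<le> 1\<^sup>2"
      unfolding one_power2 using zero_le_power2[of "b t (unit_vec k 0)"] by linarith
    then have "a t (unit_vec k 0) \<le> 1" by (rule power2_le_imp_le) simp
    ultimately show ?thesis by linarith
  qed
  have cos: "cos (theta_k Uk (X t)) = \<sigma> t" for t
    using \<sigma>_0[of t] \<sigma>_1[of t] by (simp add: theta_k_def \<sigma>_def[symmetric] cos_arccos)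
  have sin: "sin (theta_k Uk (X t)) = sqrt (1 - (\<sigma> t)\<^sup>2)" for t
    using \<sigma>_0[of t] \<sigma>_1[of t] by (simp add: theta_k_def \<sigma>_def[symmetric] sin_arccos)
  have \<sigma>_pos: "0 < \<sigma> 0" using cos0 cos by simp
  have h: "h = sqrt (1 - (\<sigma> 0)\<^sup>2) / \<sigma> 0"
    by (simp add: h_def tan_def cos sin)
  have \<sigma>2: "(\<sigma> 0)\<^sup>2 \<le> 1"
    using \<sigma>_0[of 0] \<sigma>_1[of 0] by (simp add: power_le_one)
  then have h0: "0 \<le> h" using \<sigma>_pos by (simp add: h)
  \<comment> \<open>Rearranges \<open>\<sigma>^2 * (a^2 + b^2) \<le> a^2\<close> at time 0 into a
    tangent bound for each test vector.\<close>
  have init: "b 0 y \<le> h * a 0 y" if y: "y \<in> carrier_vec k" for y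
  proof -
    have "(\<sigma> 0 * vnorm y)\<^sup>2 \<le> (a 0 y)\<^sup>2"
      using \<sigma>_le[OF y, of 0] \<sigma>_0[of 0] vnorm_nonneg[of y] by (intro power_mono) auto
    then have "(\<sigma> 0)\<^sup>2 * ((a 0 y)\<^sup>2 + (b 0 y)\<^sup>2) \<le> (a 0 y)\<^sup>2"
      by (simp add: split[OF y] power_mult_distrib)
    then have "(\<sigma> 0)\<^sup>2 * (b 0 y)\<^sup>2 \<le> (1 - (\<sigma> 0)\<^sup>2) * (a 0 y)\<^sup>2"
      by (simp add: algebra_simps)
    then have "(\<sigma> 0 * b 0 y)\<^sup>2 \<le> (sqrt (1 - (\<sigma> 0)\<^sup>2) * a 0 y)\<^sup>2"
      using \<sigma>2 by (simp add: power_mult_distrib)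
    then have "\<sigma> 0 * b 0 y \<le> sqrt (1 - (\<sigma> 0)\<^sup>2) * a 0 y"
      by (rule power2_le_imp_le) (use \<sigma>2 nn in simp)
    then show ?thesis
      using \<sigma>_pos by (simp add: h field_simps)
  qed
  interpret accelerated_power_iteration d k A lam u X R \<Xi> s g \<epsilon>
  proof
    show "s * (2 + 32 * g\<^sup>2) \<le> lam i" if "i < k" for i
      using lam_sorted[rule_format, of i "k - 1"] that dk by (simp add: \<mu>[symmetric] \<mu>_def)
    show "\<bar>lam i\<bar> \<le> 2 * s" if "k \<le> i" "i < d" for i
      using lam_sorted[rule_format, of k i] lam_nonneg[rule_format, of i] beta(3) that
      by (simp add: s_def)
    show "L2_set (\<lambda>i. u i \<bullet> (\<Xi> t *\<^sub>v y)) {0..<k} \<le> s * g\<^sup>2 * L2_set (\<lambda>i. u i \<bullet> (X t *\<^sub>v y)) {0..<k}"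
      if y: "y \<in> carrier_vec k" for t y
    proof -
      have "L2_set (\<lambda>i. u i \<bullet> (\<Xi> t *\<^sub>v y)) {0..<k} \<le> spec_norm (transpose_mat Uk * \<Xi> t) * vnorm y"
        using vnorm_mult_le_spec_norm[of "transpose_mat Uk * \<Xi> t" k k y] top[of "\<Xi> t" y] y Uk Xi_dim
        by simp
      also have "\<dots> \<le> (s * g\<^sup>2 * \<sigma> t) * vnorm y"
        using pert2[rule_format, of t, unfolded cos] unfolding \<delta>
        by (intro mult_right_mono vnorm_nonneg)
      also have "\<dots> = s * g\<^sup>2 * (\<sigma> t * vnorm y)" by simp
      also have "\<dots> \<le> s * g\<^sup>2 * a t y"
        using \<sigma>_le[OF y] s by (intro mult_left_mono) auto
      finally show ?thesis by (simp add: a_def)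
    qed
    show "L2_set (\<lambda>i. u i \<bullet> (\<Xi> t *\<^sub>v y)) {k..<d} \<le> s * g\<^sup>2 * \<epsilon> * vnorm y"
      if y: "y \<in> carrier_vec k" for t y
    proof -
      have "L2_set (\<lambda>i. u i \<bullet> (\<Xi> t *\<^sub>v y)) {k..<d} \<le> spec_norm (transpose_mat Umk * \<Xi> t) * vnorm y"
        using vnorm_mult_le_spec_norm[of "transpose_mat Umk * \<Xi> t" "d - k" k y] rest[of "\<Xi> t" y] y Umk Xi_dim
        by simp
      also have "\<dots> \<le> (s * g\<^sup>2 * \<epsilon>) * vnorm y"
        using pert1[rule_format, of t] unfolding \<delta>
        by (intro mult_right_mono vnorm_nonneg)
      finally show ?thesis .
    qed
    show "0 < L2_set (\<lambda>i. u i \<bullet> (X 0 *\<^sub>v y)) {0..<k}"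
      if y: "y \<in> carrier_vec k" "y \<noteq> 0\<^sub>v k" for y
    proof -
      have "0 < vnorm y"
        using vnorm_nonneg[of y] vnorm_eq_0_iff[OF y(1)] y(2) by linarith
      then have "0 < \<sigma> 0 * vnorm y" using \<sigma>_pos by simp
      then show ?thesis using \<sigma>_le[OF y(1), of 0] by (simp add: a_def)
    qed
    show "X 1 * R 1 = (1/2) \<cdot>\<^sub>m (A * X 0) + \<Xi> 0" by (rule QR_1)
  qed (use dk s g eps A_carrier A_sym u_dim u_orth eig X R Xi_dim QR_Suc in auto)
  fix t :: nat
  assume "real t \<ge> ln (2 * tan (theta_k Uk (X 0)) / \<epsilon>)
      / (- ln (1 - (1/2) * sqrt ((lam (k - 1) - 2 * sqrt \<beta>) / lam (k - 1))))"
  then have T: "ln (2 * h / \<epsilon>) / (- ln \<rho>) \<le> real t"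
    by (simp add: h_def \<rho>_def \<mu>_def s_def)
  have "2 * h * \<rho> ^ t \<le> \<epsilon>"
  \<comment> \<open>For \<open>h = 0\<close> the logarithm in the threshold is taken at 0 and
    carries no information, but the inequality is immediate.\<close>
  proof (cases "h = 0")
    case False
    then have pos: "0 < 2 * h / \<epsilon>" using h0 eps by simp
    have "0 < - ln \<rho>" using \<rho> by simp
    then have "ln (2 * h / \<epsilon>) \<le> real t * (- ln \<rho>)"
      using T by (simp only: pos_divide_le_eq)
    moreover have "ln (2 * h / \<epsilon> * \<rho> ^ t) = ln (2 * h / \<epsilon>) + ln (\<rho> ^ t)"
      by (rule ln_mult_pos) (use pos \<rho> in simp_all)
    moreover have "ln (\<rho> ^ t) = real t * ln \<rho>"
      by (simp add: ln_realpow)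
    ultimately have "ln (2 * h / \<epsilon> * \<rho> ^ t) \<le> 0"
      by simp
    moreover have "0 < 2 * h / \<epsilon> * \<rho> ^ t"
      using pos \<rho>(1) by (intro mult_pos_pos zero_less_power)
    ultimately have "2 * h / \<epsilon> * \<rho> ^ t \<le> 1"
      by (simp only: ln_le_zero_iff)
    then have "2 * h * \<rho> ^ t / \<epsilon> \<le> 1"
      by (simp only: times_divide_eq_left)
    then show ?thesis using eps by (simp only: pos_divide_le_eq mult_1)
  qed (use eps in simp)
  then have maj: "majorant g \<epsilon> h t \<le> \<epsilon> * gain g t"
    by (rule majorant_le_gain[OF g eps(1) \<rho> h0])
  have ba: "b t y \<le> \<epsilon> * a t y" if y: "y \<in> carrier_vec k" for y
  proof -
    have "b t y * gain g t \<le> majorant g \<epsilon> h t * a t y"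
      unfolding a_def b_def using init by (intro tangent_le h0 y) (simp add: a_def b_def)
    also have "\<dots> \<le> \<epsilon> * gain g t * a t y"
      using maj nn by (intro mult_right_mono) auto
    finally have "b t y * gain g t \<le> (\<epsilon> * a t y) * gain g t" by (simp add: mult_ac)
    then show ?thesis using gain_pos[of g t] by simp
  qed
  \<comment> \<open>A tangent of at most \<epsilon> gives a sine of at most \<epsilon>: on unit
    vectors \<open>b \<le> \<epsilon> * a\<close> and \<open>a \<le> 1\<close> force
    \<open>a^2 \<ge> 1 - \<epsilon>^2\<close>.\<close>
  have "sqrt (1 - \<epsilon>\<^sup>2) \<le> \<sigma> t"
  proof (rule le_\<sigma>)
    fix y :: "real vec" assume y: "y \<in> carrier_vec k" "vnorm y = 1"
    have 1: "(a t y)\<^sup>2 + (b t y)\<^sup>2 = 1" using split[OF y(1), of t] y by simp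
    have "(b t y)\<^sup>2 \<le> (\<epsilon> * a t y)\<^sup>2"
      using ba[OF y(1)] nn by (intro power_mono) auto
    also have "\<dots> \<le> \<epsilon>\<^sup>2 * 1"
    proof -
      have "(a t y)\<^sup>2 \<le> 1" using 1 zero_le_power2[of "b t y"] by linarith
      then show ?thesis unfolding power_mult_distrib by (intro mult_left_mono) auto
    qed
    finally have "1 - \<epsilon>\<^sup>2 \<le> (a t y)\<^sup>2" using 1 by linarith
    then show "sqrt (1 - \<epsilon>\<^sup>2) \<le> a t y"
      using nn by (simp add: real_le_lsqrt)
  qed
  then have "(sqrt (1 - \<epsilon>\<^sup>2))\<^sup>2 \<le> (\<sigma> t)\<^sup>2"
    using eps by (intro power_mono) (auto simp: power_le_one)
  then have "1 - (\<sigma> t)\<^sup>2 \<le> \<epsilon>\<^sup>2"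
    using eps by (simp add: power_le_one)
  then show "sin (theta_k Uk (X t)) \<le> \<epsilon>"
    unfolding sin using eps by (intro real_le_lsqrt) auto
qed

end
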